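(* An arbitrary solvable Leibniz algebra with a codimension one nilradical $\mathcal{L}(1,-1,0)$ is isomorphic to one of the following non-isomorphic algebras: $$R_{n+1}^1(1,-1,0),\ R_{n+1}^2(1,-1,0).$$
   Context: All algebras are finite-dimensional over $\mathbb{C}$. A Leibniz algebra is a vector space $L$ with a bilinear bracket satisfying $[x,[y,z]]=[[x,y],z]-[[x,z],y]$ for all $x,y,z\in L$. $L$ is nilpotent if the lower central series $L^1=L$, $L^{k+1}=[L^k,L]$ reaches $0$, and solvable if the derived series $L^{[1]}=L$, $L^{[s+1]}=[L^{[s]},L^{[s]}]$ reaches $0$. The nilradical is the maximal nilpotent two-sided ideal; it has codimension one if a complementary subspace to it is one-dimensional. In every multiplication table, products of basis elements that are not listed are zero. The $n$-dimensional nilpotent Leibniz algebra $\mathcal{L}(1,-1,0)$ has basis $e_1,\dots,e_n$ and products $$[e_i,e_1]=e_{i+1}\ (1\le i\le n-3),\quad [e_{n-1},e_1]=e_n+e_2,\quad [e_1,e_{n-1}]=-e_n.$$ The $(n+1)$-dimensional algebras $R_{n+1}^1(1,-1,0)$ and $R_{n+1}^2(1,-1,0)$ have basis $e_1,\dots,e_n,x$; their products are those of $\mathcal{L}(1,-1,0)$ among $e_1,\dots,e_n$ together with the following. $R_{n+1}^1(1,-1,0)$: $[e_1,x]=e_1-e_{n-1}$, $[e_i,x]=(i-1)e_i$ $(2\le i\le n-2)$, $[e_n,x]=e_n$, $[x,e_1]=-e_1+e_{n-1}$, $[x,e_n]=-e_n$. $R_{n+1}^2(1,-1,0)$: $[e_1,x]=e_1-e_{n-1}$,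 $[e_i,x]=(i-1)e_i$ $(2\le i\le n-2)$, $[e_n,x]=e_n$, $[x,e_1]=-e_1+e_2+e_{n-1}$, $[x,e_n]=-e_n$.
   Formalization: The dimension n of L(1,-1,0) is assumed to be at least 5: for n = 4 the classification is false (there is an extension where right multiplication by x has eigenvalues 1,1,2,2 on the nilradical), and for n = 3 the given table is not nilpotent. *)

theory Defs
  imports Complex_Main "HOL-Library.Function_Algebras"
begin

(* An algebra is a subspace carr of an ambient complex vector space (the type 'a with
   scalar multiplication smul) together with a product bracket, whose values matter only
   on carr. Replacing carr by a smaller subspace, A\<lparr>carr := N\<rparr>, turns a subalgebra or ideal
   N of A into an algebra in its own right. *)
record 'a alg =
  carr :: "'a set"
  smul :: "complex \<Rightarrow> 'a \<Rightarrow> 'a"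
  bracket :: "'a \<Rightarrow> 'a \<Rightarrow> 'a"

definition fin_dim_algebra :: "'a::ab_group_add alg \<Rightarrow> bool" where
  "fin_dim_algebra A \<longleftrightarrow>
     vector_space (smul A) \<and>
     module.subspace (smul A) (carr A) \<and>
     (\<exists>B. finite B \<and> B \<subseteq> carr A \<and> module.span (smul A) B = carr A) \<and>
     (\<forall>x\<in>carr A. \<forall>y\<in>carr A. bracket A x y \<in> carr A) \<and>
     (\<forall>x\<in>carr A. \<forall>y\<in>carr A. \<forall>z\<in>carr A.
        bracket A (x + y) z = bracket A x z + bracket A y z \<and>
        bracket A z (x + y) = bracket A z x + bracket A z y) \<and>
     (\<forall>c. \<forall>x\<in>carr A. \<forall>y\<in>carr A.
        bracket A (smul A c x) y = smul A c (bracket A x y) \<and>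
        bracket A x (smul A c y) = smul A c (bracket A x y))"

definition leibniz_algebra :: "'a::ab_group_add alg \<Rightarrow> bool" where
  "leibniz_algebra A \<longleftrightarrow> fin_dim_algebra A \<and>
     (\<forall>x\<in>carr A. \<forall>y\<in>carr A. \<forall>z\<in>carr A.
        bracket A x (bracket A y z) =
        bracket A (bracket A x y) z - bracket A (bracket A x z) y)"

definition product_space :: "'a::ab_group_add alg \<Rightarrow> 'a set \<Rightarrow> 'a set \<Rightarrow> 'a set" where
  "product_space A U V = module.span (smul A) {bracket A u v | u v. u \<in> U \<and> v \<in> V}"

(* Both series are indexed from 0: lower_central A k is the term with superscript k + 1,
   and likewise for derived_series. *)
primrec lower_central :: "'a::ab_group_add alg \<Rightarrow> nat \<Rightarrow> 'a set" where
  "lower_central A 0 = carr A"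
| "lower_central A (Suc k) = product_space A (lower_central A k) (carr A)"

primrec derived_series :: "'a::ab_group_add alg \<Rightarrow> nat \<Rightarrow> 'a set" where
  "derived_series A 0 = carr A"
| "derived_series A (Suc k) = product_space A (derived_series A k) (derived_series A k)"

definition nilpotent_alg :: "'a::ab_group_add alg \<Rightarrow> bool" where
  "nilpotent_alg A \<longleftrightarrow> (\<exists>k. lower_central A k = {0})"

definition solvable_alg :: "'a::ab_group_add alg \<Rightarrow> bool" where
  "solvable_alg A \<longleftrightarrow> (\<exists>k. derived_series A k = {0})"

definition ideal_of :: "'a::ab_group_add alg \<Rightarrow> 'a set \<Rightarrow> bool" where
  "ideal_of A I \<longleftrightarrow> module.subspace (smul A) I \<and> I \<subseteq> carr A \<and>
     (\<forall>x\<in>carr A. \<forall>y\<in>I. bracket A x y \<in> I \<and> bracket A y x \<in> I)"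

definition nilradical :: "'a::ab_group_add alg \<Rightarrow> 'a set \<Rightarrow> bool" where
  "nilradical A N \<longleftrightarrow>
     ideal_of A N \<and> nilpotent_alg (A\<lparr>carr := N\<rparr>) \<and>
     (\<forall>I. ideal_of A I \<and> nilpotent_alg (A\<lparr>carr := I\<rparr>) \<longrightarrow> I \<subseteq> N)"

definition codim_one :: "'a::ab_group_add alg \<Rightarrow> 'a set \<Rightarrow> bool" where
  "codim_one A N \<longleftrightarrow> (\<exists>Q. module.subspace (smul A) Q \<and>
     N \<inter> Q = {0} \<and> {u + q | u q. u \<in> N \<and> q \<in> Q} = carr A \<and>
     vector_space.dim (smul A) Q = 1)"

definition isomorphic_alg ::
    "'a::ab_group_add alg \<Rightarrow> 'b::ab_group_add alg \<Rightarrow> bool" (infix "\<cong>" 50) where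
  "A \<cong> B \<longleftrightarrow> (\<exists>f. bij_betw f (carr A) (carr B) \<and>
     (\<forall>x\<in>carr A. \<forall>y\<in>carr A. f (x + y) = f x + f y) \<and>
     (\<forall>c. \<forall>x\<in>carr A. f (smul A c x) = smul B c (f x)) \<and>
     (\<forall>x\<in>carr A. \<forall>y\<in>carr A. f (bracket A x y) = bracket B (f x) (f y)))"

(* Coordinate vectors are functions nat \<Rightarrow> complex vanishing outside the indices 1, ..., m. *)

definition csmul :: "complex \<Rightarrow> (nat \<Rightarrow> complex) \<Rightarrow> nat \<Rightarrow> complex" where
  "csmul c v = (\<lambda>k. c * v k)"

definition basis_vec :: "nat \<Rightarrow> nat \<Rightarrow> complex" where
  "basis_vec i = (\<lambda>k. if k = i then 1 else 0)"

(* The m-dimensional algebra with basis e_i = basis_vec i, i = 1, ..., m, and products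
   [e_i, e_j] = T i j. *)
definition table_algebra ::
    "nat \<Rightarrow> (nat \<Rightarrow> nat \<Rightarrow> nat \<Rightarrow> complex) \<Rightarrow> (nat \<Rightarrow> complex) alg" where
  "table_algebra m T =
     \<lparr>carr = {v. \<forall>k. k \<notin> {1..m} \<longrightarrow> v k = 0},
      smul = csmul,
      bracket = (\<lambda>u v. \<Sum>i=1..m. \<Sum>j=1..m. csmul (u i * v j) (T i j))\<rparr>"

definition nil_table :: "nat \<Rightarrow> nat \<Rightarrow> nat \<Rightarrow> nat \<Rightarrow> complex" where
  "nil_table n i j =
     (if 1 \<le> i \<and> i \<le> n - 3 \<and> j = 1 then basis_vec (i + 1)
      else if i = n - 1 \<and> j = 1 then basis_vec n + basis_vec 2
      else if i = 1 \<and> j = n - 1 then - basis_vec n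
      else 0)"

(* In the two extended tables the additional basis vector x is basis_vec (n + 1). *)
definition R1_table :: "nat \<Rightarrow> nat \<Rightarrow> nat \<Rightarrow> nat \<Rightarrow> complex" where
  "R1_table n i j =
     (if i = 1 \<and> j = n + 1 then basis_vec 1 - basis_vec (n - 1)
      else if 2 \<le> i \<and> i \<le> n - 2 \<and> j = n + 1 then csmul (of_nat (i - 1)) (basis_vec i)
      else if i = n \<and> j = n + 1 then basis_vec n
      else if i = n + 1 \<and> j = 1 then - basis_vec 1 + basis_vec (n - 1)
      else if i = n + 1 \<and> j = n then - basis_vec n
      else nil_table n i j)"

definition R2_table :: "nat \<Rightarrow> nat \<Rightarrow> nat \<Rightarrow> nat \<Rightarrow> complex" where
  "R2_table n i j =
     (if i = 1 \<and> j = n + 1 then basis_vec 1 - basis_vec (n - 1)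
      else if 2 \<le> i \<and> i \<le> n - 2 \<and> j = n + 1 then csmul (of_nat (i - 1)) (basis_vec i)
      else if i = n \<and> j = n + 1 then basis_vec n
      else if i = n + 1 \<and> j = 1 then - basis_vec 1 + basis_vec 2 + basis_vec (n - 1)
      else if i = n + 1 \<and> j = n then - basis_vec n
      else nil_table n i j)"

definition nil_alg :: "nat \<Rightarrow> (nat \<Rightarrow> complex) alg" where
  "nil_alg n = table_algebra n (nil_table n)"

definition R1_alg :: "nat \<Rightarrow> (nat \<Rightarrow> complex) alg" where
  "R1_alg n = table_algebra (n + 1) (R1_table n)"

definition R2_alg :: "nat \<Rightarrow> (nat \<Rightarrow> complex) alg" where
  "R2_alg n = table_algebra (n + 1) (R2_table n)"

end

theory Submission
  imports Defs
begin

text \<open>Write \<open>R = N + \<complex>x\<close>. The derivation \<open>D = [\<cdot>, x]\<close> of \<open>N\<close> is triangular, with eigenvalues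
  determined by those on \<open>e_1\<close> and \<open>e_{n-1}\<close>. Squares lie in the right annihilator, and this
  together with \<open>[x, [e_n, e_1]] = 0\<close> forces the eigenvalue on \<open>e_{n-1}\<close> to be 0. If the eigenvalue
  on \<open>e_1\<close> vanished too, \<open>R\<close> would be nilpotent, so it may be scaled to 1. The algebra \<open>N\<close> is
  generated by \<open>h = e_1 - e_{n-1}\<close> and \<open>f = e_{n-1}\<close>, with \<open>[h,h] = [f,f] = 0\<close>; correcting \<open>h\<close>, \<open>f\<close>
  and \<open>x\<close> so that \<open>D h = h\<close> and \<open>D f = 0\<close> makes \<open>D\<close> diagonal on the basis they generate. The Leibniz
  identities for \<open>[x, [x, f]]\<close> and \<open>[x, [x, e_1]]\<close> then determine \<open>[x, \<cdot>]\<close> up to the coefficient of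
  \<open>e_2\<close> in \<open>[x, e_1]\<close>, after a shift of \<open>x\<close> by an element of the right annihilator of \<open>R\<close>. Scaling the
  basis makes this coefficient 0 or 1.

  The first algebra contains \<open>X, H, G\<close> with \<open>[H,X] = H\<close>, \<open>[X,H] = -H\<close>, \<open>[H,H] = 0\<close> and
  \<open>[[G,G],H] \<noteq> 0\<close> (take \<open>x, h, e_1\<close>), whereas comparing coordinates excludes this in the second.\<close>

section \<open>Algebras given by structure constants\<close>

definition supp :: "nat \<Rightarrow> (nat \<Rightarrow> complex) set" where
  "supp m = {v. \<forall>k. k \<notin> {1..m} \<longrightarrow> v k = 0}"

text \<open>Scalar multiplication is an argument so that the same map serves an abstract algebra and
  the coordinate space. When \<open>b\<close> is a basis this is the inverse of the coordinate
  map.\<close>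

definition lin :: "('f \<Rightarrow> 'a \<Rightarrow> 'a::comm_monoid_add) \<Rightarrow> (nat \<Rightarrow> 'a) \<Rightarrow> nat \<Rightarrow> (nat \<Rightarrow> 'f) \<Rightarrow> 'a" where
  "lin s b m c = (\<Sum>k=1..m. s (c k) (b k))"

text \<open>The bilinear structure is kept apart from \<open>leibniz_id\<close>: for a table it can
  be checked at once, whereas the Leibniz identity is carried over along an isomorphism.\<close>

definition bilinear_alg :: "'a::ab_group_add alg \<Rightarrow> bool" where
  "bilinear_alg A \<longleftrightarrow>
     vector_space (smul A) \<and> module.subspace (smul A) (carr A) \<and>
     (\<forall>x\<in>carr A. \<forall>y\<in>carr A. bracket A x y \<in> carr A) \<and>
     (\<forall>x\<in>carr A. \<forall>y\<in>carr A. \<forall>z\<in>carr A.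
        bracket A (x + y) z = bracket A x z + bracket A y z \<and>
        bracket A z (x + y) = bracket A z x + bracket A z y) \<and>
     (\<forall>c. \<forall>x\<in>carr A. \<forall>y\<in>carr A.
        bracket A (smul A c x) y = smul A c (bracket A x y) \<and>
        bracket A x (smul A c y) = smul A c (bracket A x y))"

definition leibniz_id :: "'a::ab_group_add alg \<Rightarrow> bool" where
  "leibniz_id A \<longleftrightarrow> (\<forall>x\<in>carr A. \<forall>y\<in>carr A. \<forall>z\<in>carr A.
        bracket A x (bracket A y z) =
        bracket A (bracket A x y) z - bracket A (bracket A x z) y)"

lemma leibniz_algebraD:
  "leibniz_algebra A \<Longrightarrow> bilinear_alg A" "leibniz_algebra A \<Longrightarrow> leibniz_id A"
  by (auto simp: leibniz_algebra_def fin_dim_algebra_def bilinear_alg_def leibniz_id_def)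

section \<open>Coordinate vectors and linear combinations\<close>

lemma csmul_apply [simp]: "csmul c v k = c * v k"
  by (simp add: csmul_def)

lemma basis_vec_apply: "basis_vec i k = (if k = i then 1 else 0)"
  by (simp add: basis_vec_def)

lemma vector_space_csmul: "vector_space csmul"
  by unfold_locales (auto simp: fun_eq_iff algebra_simps)

interpretation cvec: vector_space csmul
  by (rule vector_space_csmul)

lemma supp_zero [simp]: "0 \<in> supp m"
  by (simp add: supp_def)

lemma supp_add [simp]: "u \<in> supp m \<Longrightarrow> v \<in> supp m \<Longrightarrow> u + v \<in> supp m"
  by (simp add: supp_def)

lemma supp_diff [simp]: "u \<in> supp m \<Longrightarrow> v \<in> supp m \<Longrightarrow> u - v \<in> supp m"
  by (simp add: supp_def)

lemma supp_uminus [simp]: "u \<in> supp m \<Longrightarrow> - u \<in> supp m"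
  by (simp add: supp_def)

lemma supp_csmul [simp]: "u \<in> supp m \<Longrightarrow> csmul c u \<in> supp m"
  by (simp add: supp_def)

lemma supp_basis_vec [simp]: "basis_vec i \<in> supp m \<longleftrightarrow> 1 \<le> i \<and> i \<le> m"
  by (auto simp: supp_def basis_vec_apply)

lemma supp_outside: "u \<in> supp m \<Longrightarrow> k \<notin> {1..m} \<Longrightarrow> u k = 0"
  by (auto simp: supp_def)

lemma supp_mono: "u \<in> supp m \<Longrightarrow> m \<le> l \<Longrightarrow> u \<in> supp l"
  by (auto simp: supp_def)

lemma subspace_supp: "cvec.subspace (supp m)"
  by (simp add: cvec.subspace_def)

lemma supp_sum: "(\<And>i. i \<in> I \<Longrightarrow> f i \<in> supp m) \<Longrightarrow> sum f I \<in> supp m"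
  by (rule cvec.subspace_sum[OF subspace_supp])

lemma sum_fun_apply: "(\<Sum>i\<in>I. f i) k = (\<Sum>i\<in>I. f i k)"
  for f :: "'b \<Rightarrow> 'c \<Rightarrow> 'd::comm_monoid_add"
  by (induction I rule: infinite_finite_induct) auto

lemma lin_csmul_apply: "lin csmul b m c k = (\<Sum>i=1..m. c i * b i k)"
  by (simp add: lin_def sum_fun_apply)

context vector_space
begin

lemma lin_add: "lin scale b m (u + v) = lin scale b m u + lin scale b m v"
  by (simp add: lin_def scale_left_distrib sum.distrib)

lemma lin_diff: "lin scale b m (u - v) = lin scale b m u - lin scale b m v"
  by (simp add: lin_def scale_left_diff_distrib sum_subtractf)

lemma lin_uminus: "lin scale b m (- u) = - lin scale b m u"
  by (simp add: lin_def sum_negf)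

lemma lin_zero: "lin scale b m 0 = 0"
  by (simp add: lin_def)

end

lemma lin_csmul:
  assumes "vector_space s"
  shows "lin s b m (csmul c u) = s c (lin s b m u)"
proof -
  interpret vector_space s by fact
  show ?thesis by (simp add: lin_def scale_sum_right)
qed

lemma lin_basis_vec:
  assumes "vector_space s" "1 \<le> i" "i \<le> m"
  shows "lin s b m (basis_vec i) = b i"
proof -
  interpret vector_space s by fact
  have "lin s b m (basis_vec i) = (\<Sum>k=1..m. if k = i then b k else 0)"
    unfolding lin_def by (rule sum.cong) (auto simp: basis_vec_apply)
  then show ?thesis using assms by simp
qed

lemma lin_self: "u \<in> supp m \<Longrightarrow> lin csmul basis_vec m u = u"
  by (auto simp: fun_eq_iff lin_csmul_apply basis_vec_apply supp_def
      if_distrib[of "\<lambda>x. _ * x"] cong: if_cong)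

section \<open>Isomorphisms and products given by tables\<close>

lemma isomorphic_algE:
  assumes "A \<cong> B"
  obtains f where "bij_betw f (carr A) (carr B)" 
    "\<And>x y. x \<in> carr A \<Longrightarrow> y \<in> carr A \<Longrightarrow> f (x + y) = f x + f y"
    "\<And>c x. x \<in> carr A \<Longrightarrow> f (smul A c x) = smul B c (f x)"
    "\<And>x y. x \<in> carr A \<Longrightarrow> y \<in> carr A \<Longrightarrow> f (bracket A x y) = bracket B (f x) (f y)"
  using assms unfolding isomorphic_alg_def by (elim exE conjE) (rule that, assumption, simp_all)

lemma isomorphic_alg_trans:
  assumes "A \<cong> B" "B \<cong> C"
  shows "A \<cong> C"
proof -
  obtain f where f: "bij_betw f (carr A) (carr B)" 
      "\<And>x y. x \<in> carr A \<Longrightarrow> y \<in> carr A \<Longrightarrow> f (x + y) = f x + f y"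
      "\<And>c x. x \<in> carr A \<Longrightarrow> f (smul A c x) = smul B c (f x)"
      "\<And>x y. x \<in> carr A \<Longrightarrow> y \<in> carr A \<Longrightarrow> f (bracket A x y) = bracket B (f x) (f y)"
    by (rule isomorphic_algE[OF assms(1)], rule that; assumption)
  obtain g where g: "bij_betw g (carr B) (carr C)" 
      "\<And>x y. x \<in> carr B \<Longrightarrow> y \<in> carr B \<Longrightarrow> g (x + y) = g x + g y"
      "\<And>c x. x \<in> carr B \<Longrightarrow> g (smul B c x) = smul C c (g x)"
      "\<And>x y. x \<in> carr B \<Longrightarrow> y \<in> carr B \<Longrightarrow> g (bracket B x y) = bracket C (g x) (g y)"
    by (rule isomorphic_algE[OF assms(2)], rule that; assumption)
  have "f x \<in> carr B" if "x \<in> carr A" for x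
    using f(1) that by (auto simp: bij_betw_def)
  then show ?thesis
    unfolding isomorphic_alg_def using bij_betw_trans[OF f(1) g(1)]
    by (intro exI[of _ "g \<circ> f"]) (simp add: f(2-) g(2-))
qed

lemma table_algebra_simps [simp]:
  "carr (table_algebra m T) = supp m" "smul (table_algebra m T) = csmul"
  by (simp_all add: table_algebra_def supp_def)

lemma table_bracket_apply:
  "bracket (table_algebra m T) u v k = (\<Sum>i=1..m. \<Sum>j=1..m. u i * v j * T i j k)"
  by (simp add: table_algebra_def sum_fun_apply)

lemma table_bracket_basis:
  assumes "i \<in> {1..m}" "j \<in> {1..m}"
  shows "bracket (table_algebra m T) (basis_vec i) (basis_vec j) = T i j"
proof
  fix k
  have "bracket (table_algebra m T) (basis_vec i) (basis_vec j) k =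
    (\<Sum>i'=1..m. if i' = i then (\<Sum>j'=1..m. if j' = j then T i j k else 0) else 0)"
    unfolding table_bracket_apply
    by (intro sum.cong refl) (simp add: basis_vec_apply if_distrib[of "\<lambda>x. x * _"] cong: if_cong)
  then show "bracket (table_algebra m T) (basis_vec i) (basis_vec j) k = T i j k"
    using assms by simp
qed

lemma table_bracket_bilinear:
  "bracket (table_algebra m T) (u + v) w = bracket (table_algebra m T) u w + bracket (table_algebra m T) v w"
  "bracket (table_algebra m T) w (u + v) = bracket (table_algebra m T) w u + bracket (table_algebra m T) w v"
  "bracket (table_algebra m T) (csmul c u) w = csmul c (bracket (table_algebra m T) u w)"
  "bracket (table_algebra m T) w (csmul c u) = csmul c (bracket (table_algebra m T) w u)"
  by (auto simp: fun_eq_iff table_bracket_apply algebra_simps sum.distrib sum_distrib_left)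

lemma table_bracket_cong:
  assumes "\<And>i j. i \<in> {1..m} \<Longrightarrow> j \<in> {1..m} \<Longrightarrow> T i j = T' i j"
  shows "table_algebra m T = table_algebra m T'"
  unfolding table_algebra_def by (auto simp: fun_eq_iff sum_fun_apply assms intro!: sum.cong)

lemma table_bracket_supp:
  assumes "\<And>i j. i \<in> {1..m} \<Longrightarrow> j \<in> {1..m} \<Longrightarrow> T i j \<in> supp l"
  shows "bracket (table_algebra m T) u v \<in> supp l"
  by (simp add: table_algebra_def) (intro supp_sum supp_csmul assms; simp)

lemma bilinear_table_algebra:
  assumes "\<And>i j. i \<in> {1..m} \<Longrightarrow> j \<in> {1..m} \<Longrightarrow> T i j \<in> supp m"
  shows "bilinear_alg (table_algebra m T)"
proof -
  have "bracket (table_algebra m T) u v \<in> supp m" for u v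
    by (rule table_bracket_supp) (rule assms)
  then show ?thesis
    unfolding bilinear_alg_def
    by (simp add: vector_space_csmul subspace_supp table_bracket_bilinear)
qed

text \<open>Every element of \<open>carr B\<close> is an image under the isomorphism, which respects
  differences as well as products. Structure constants in a new basis thus inherit the identity
  without any computation.\<close>

lemma leibniz_id_transport:
  assumes "A \<cong> B" "bilinear_alg A" "leibniz_id A"
  shows "leibniz_id B"
proof -
  interpret vector_space "smul A"
    using assms(2) by (simp add: bilinear_alg_def)
  have cl: "\<And>x y. x \<in> carr A \<Longrightarrow> y \<in> carr A \<Longrightarrow> bracket A x y \<in> carr A"
    and sub: "subspace (carr A)"
    using assms(2) by (auto simp: bilinear_alg_def)
  obtain f where f: "bij_betw f (carr A) (carr B)" 
      "\<And>x y. x \<in> carr A \<Longrightarrow> y \<in> carr A \<Longrightarrow> f (x + y) = f x + f y"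
      "\<And>x y. x \<in> carr A \<Longrightarrow> y \<in> carr A \<Longrightarrow> f (bracket A x y) = bracket B (f x) (f y)"
    by (rule isomorphic_algE[OF assms(1)], rule that; assumption)
  have fd: "f (x - y) = f x - f y" if "x \<in> carr A" "y \<in> carr A" for x y
    using f(2)[of "x - y" y] that subspace_diff[OF sub] by (simp add: algebra_simps)
  have "bracket B (f x) (bracket B (f y) (f z)) =
        bracket B (bracket B (f x) (f y)) (f z) - bracket B (bracket B (f x) (f z)) (f y)"
    if "x \<in> carr A" "y \<in> carr A" "z \<in> carr A" for x y z
  proof -
    have "f (bracket A x (bracket A y z)) =
        f (bracket A (bracket A x y) z - bracket A (bracket A x z) y)"
      using assms(3) that by (simp add: leibniz_id_def)
    then show ?thesis by (simp add: fd f(3) cl that)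
  qed
  moreover have "carr B = f ` carr A"
    using f(1) by (simp add: bij_betw_def)
  ultimately show ?thesis
    unfolding leibniz_id_def by simp
qed

section \<open>Change of basis\<close>

lemma bracket_lin:
  assumes "bilinear_alg A" "\<And>i. i \<in> {1..m} \<Longrightarrow> b i \<in> carr A"
  shows "bracket A (lin (smul A) b m u) (lin (smul A) b m v) =
    (\<Sum>i=1..m. \<Sum>j=1..m. smul A (u i * v j) (bracket A (b i) (b j)))"
proof -
  interpret vector_space "smul A"
    using assms(1) by (simp add: bilinear_alg_def)
  have sub: "subspace (carr A)" using assms(1) by (simp add: bilinear_alg_def)
  have add: "\<And>x y z. x \<in> carr A \<Longrightarrow> y \<in> carr A \<Longrightarrow> z \<in> carr A \<Longrightarrow> 
        bracket A (x + y) z = bracket A x z + bracket A y z"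
     "\<And>x y z. x \<in> carr A \<Longrightarrow> y \<in> carr A \<Longrightarrow> z \<in> carr A \<Longrightarrow> 
        bracket A z (x + y) = bracket A z x + bracket A z y" and
     sc: "\<And>c x y. x \<in> carr A \<Longrightarrow> y \<in> carr A \<Longrightarrow> bracket A (smul A c x) y = smul A c (bracket A x y)"
     "\<And>c x y. x \<in> carr A \<Longrightarrow> y \<in> carr A \<Longrightarrow> bracket A x (smul A c y) = smul A c (bracket A x y)"
    using assms(1) by (simp_all add: bilinear_alg_def)
  have zero: "bracket A 0 z = 0" "bracket A z 0 = 0" if "z \<in> carr A" for z
    using sc(1)[of z z 0] sc(2)[of z z 0] that by simp_all
  have mem: "smul A c (b i) \<in> carr A" if "i \<in> {1..m}" for c i
    using that assms(2) sub by (auto intro: subspace_scale)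
  \<comment> \<open>Bilinearity is available on \<open>carr A\<close> only, so the inductions below
    need every partial sum to stay there.\<close>
  have memsum: "(\<Sum>i\<in>I. smul A (w i) (b i)) \<in> carr A" if "I \<subseteq> {1..m}" for I w
    using that mem by (intro subspace_sum[OF sub]) auto
  have right: "bracket A y (\<Sum>j\<in>J. smul A (v j) (b j)) = (\<Sum>j\<in>J. smul A (v j) (bracket A y (b j)))"
    if "J \<subseteq> {1..m}" "y \<in> carr A" for J y
  proof -
    have "finite J" using that finite_subset by blast
    from this that show ?thesis
      by (induction J) (use mem memsum assms(2) in \<open>auto simp: zero add sc\<close>)
  qed
  have left: "bracket A (\<Sum>j\<in>J. smul A (u j) (b j)) y = (\<Sum>j\<in>J. smul A (u j) (bracket A (b j) y))"
    if "J \<subseteq> {1..m}" "y \<in> carr A" for J y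
  proof -
    have "finite J" using that finite_subset by blast
    from this that show ?thesis
      by (induction J) (use mem memsum assms(2) in \<open>auto simp: zero add sc\<close>)
  qed
  have "bracket A (lin (smul A) b m u) (lin (smul A) b m v) =
    (\<Sum>i=1..m. smul A (u i) (bracket A (b i) (\<Sum>j=1..m. smul A (v j) (b j))))"
    unfolding lin_def by (rule left) (auto intro: memsum)
  also have "\<dots> = (\<Sum>i=1..m. smul A (u i) (\<Sum>j=1..m. smul A (v j) (bracket A (b i) (b j))))"
    by (intro sum.cong refl) (simp add: right assms(2))
  finally show ?thesis by (simp add: scale_sum_right)
qed

text \<open>The inverse of the linear combination map is the isomorphism, and \<open>T i j\<close>
  is the coordinate vector of the product of two basis elements. All three basis changes of the
  proof go through this lemma.\<close>

lemma basis_iso: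
  assumes A: "bilinear_alg A" and bij: "bij_betw (lin (smul A) b m) (supp m) (carr A)"
  obtains T where "A \<cong> table_algebra m T"
    "\<And>i j. i \<in> {1..m} \<Longrightarrow> j \<in> {1..m} \<Longrightarrow> T i j \<in> supp m"
    "\<And>i j. i \<in> {1..m} \<Longrightarrow> j \<in> {1..m} \<Longrightarrow> lin (smul A) b m (T i j) = bracket A (b i) (b j)"
proof -
  have vs: "vector_space (smul A)" using A by (simp add: bilinear_alg_def)
  interpret vector_space "smul A" by (rule vs)
  have cl: "\<And>x y. x \<in> carr A \<Longrightarrow> y \<in> carr A \<Longrightarrow> bracket A x y \<in> carr A"
    and sub: "subspace (carr A)"
    using A by (auto simp: bilinear_alg_def)
  let ?P = "lin (smul A) b m" 
  let ?f = "inv_into (supp m) ?P"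
  have b: "b i \<in> carr A" if "i \<in> {1..m}" for i
    using bij_betw_apply[OF bij, of "basis_vec i"] that lin_basis_vec[OF vs] by simp
  have Pf: "?P (?f y) = y" "?f y \<in> supp m" if "y \<in> carr A" for y
    using that bij_betw_inv_into_right[OF bij] bij_betw_apply[OF bij_betw_inv_into[OF bij]] by auto
  have fP: "?f (?P u) = u" if "u \<in> supp m" for u
    using that bij_betw_inv_into_left[OF bij] by auto
  define T where "T i j = ?f (bracket A (b i) (b j))" for i j
  have T: "T i j \<in> supp m" "?P (T i j) = bracket A (b i) (b j)"
    if "i \<in> {1..m}" "j \<in> {1..m}" for i j
    using that by (simp_all add: T_def Pf b cl)
  have P0: "?P (\<lambda>_. 0) = 0"
    using lin_zero by (simp add: zero_fun_def)
  have Padd: "?P (u + v) = ?P u + ?P v" for u v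
    by (rule lin_add)
  have Psum: "?P (\<Sum>i\<in>I. g i) = (\<Sum>i\<in>I. ?P (g i))" for I :: "nat set" and g
    by (induction I rule: infinite_finite_induct) (simp_all add: P0 lin_zero Padd del: plus_fun_apply)
  have br: "bracket A (?P u) (?P v) = ?P (bracket (table_algebra m T) u v)" for u v
  proof -
    have "?P (bracket (table_algebra m T) u v) =
      (\<Sum>i=1..m. \<Sum>j=1..m. smul A (u i * v j) (?P (T i j)))"
      by (simp add: table_algebra_def Psum lin_csmul[OF vs])
    also have "\<dots> = (\<Sum>i=1..m. \<Sum>j=1..m. smul A (u i * v j) (bracket A (b i) (b j)))"
      by (intro sum.cong refl) (simp add: T)
    finally show ?thesis using bracket_lin[OF A b] by simp
  qed
  have "A \<cong> table_algebra m T"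
    unfolding isomorphic_alg_def
  proof (intro exI[of _ ?f] conjI ballI allI)
    show "bij_betw ?f (carr A) (carr (table_algebra m T))"
      using bij_betw_inv_into[OF bij] by simp
  next
    fix x y assume xy: "x \<in> carr A" "y \<in> carr A"
    have "?f (?P (?f x + ?f y)) = ?f x + ?f y"
      by (rule fP) (simp add: Pf xy)
    then show "?f (x + y) = ?f x + ?f y"
      by (simp add: lin_add Pf xy)
    have "?f (?P (bracket (table_algebra m T) (?f x) (?f y))) = bracket (table_algebra m T) (?f x) (?f y)"
      by (rule fP) (rule table_bracket_supp, rule T)
    then show "?f (bracket A x y) = bracket (table_algebra m T) (?f x) (?f y)"
      by (simp add: br[symmetric] Pf xy)
  next
    fix c x assume x: "x \<in> carr A"
    have "?f (?P (csmul c (?f x))) = csmul c (?f x)"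
      by (rule fP) (simp add: Pf x)
    then show "?f (smul A c x) = smul (table_algebra m T) c (?f x)"
      by (simp add: lin_csmul[OF vs] Pf x)
  qed
  with T that show ?thesis by blast
qed

text \<open>Ordered by the weight \<open>r\<close>, the matrix of \<open>b\<close> is triangular
  with nonzero diagonal. Weights need not be distinct, since an off-diagonal entry must strictly
  raise the weight.\<close>

lemma triangular_bij:
  fixes b :: "nat \<Rightarrow> nat \<Rightarrow> complex" and r :: "nat \<Rightarrow> nat"
  assumes b: "\<And>i. i \<in> {1..m} \<Longrightarrow> b i \<in> supp m"
    and diag: "\<And>i. i \<in> {1..m} \<Longrightarrow> b i i \<noteq> 0"
    and tri: "\<And>i k. i \<in> {1..m} \<Longrightarrow> k \<in> {1..m} \<Longrightarrow> k \<noteq> i \<Longrightarrow> b i k \<noteq> 0 \<Longrightarrow> r i < r k"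
  shows "bij_betw (lin csmul b m) (supp m) (supp m)"
proof -
  let ?P = "lin csmul b m"
  have inj0: "c = 0" if c: "c \<in> supp m" "?P c = 0" for c
  proof (rule ccontr)
    assume "c \<noteq> 0"
    then obtain i0 where "c i0 \<noteq> 0" by (auto simp: fun_eq_iff)
    \<comment> \<open>An index of least weight among the nonzero coefficients: no other term of the
      combination reaches coordinate \<open>i\<close>.\<close>
    then obtain i where i: "c i \<noteq> 0" "\<And>j. c j \<noteq> 0 \<Longrightarrow> r i \<le> r j"
      using ex_has_least_nat[of "\<lambda>i. c i \<noteq> 0" i0 r] by blast
    have im: "i \<in> {1..m}" using i(1) c(1) supp_outside by blast
    have "?P c i = (\<Sum>j=1..m. if j = i then c i * b i i else 0)"
      unfolding lin_csmul_apply
    proof (rule sum.cong)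
      fix j assume "j \<in> {1..m}"
      then show "c j * b j i = (if j = i then c i * b i i else 0)"
        using tri[of j i] i(2)[of j] im by force
    qed simp
    then have "?P c i = c i * b i i" using im by simp
    with c(2) i(1) diag[OF im] show False by simp
  qed
  have "inj_on ?P (supp m)"
  proof (rule inj_onI)
    fix u v assume uv: "u \<in> supp m" "v \<in> supp m" "?P u = ?P v"
    have "u - v = 0" by (rule inj0) (simp_all add: cvec.lin_diff uv)
    then show "u = v" by simp
  qed
  moreover have "?P c \<in> supp m" for c
    unfolding lin_def using b by (intro supp_sum) simp
  moreover have "v \<in> ?P ` supp m" if "v \<in> supp m" for v
  proof -
    have sub: "cvec.subspace (?P ` supp m)"
      unfolding cvec.subspace_def
    proof (intro conjI ballI allI)
      show "0 \<in> ?P ` supp m" by (rule image_eqI[of _ _ 0]) (simp_all add: cvec.lin_zero)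
      show "x + y \<in> ?P ` supp m" if "x \<in> ?P ` supp m" "y \<in> ?P ` supp m" for x y
      proof -
        from that obtain u v where "u \<in> supp m" "v \<in> supp m" "x = ?P u" "y = ?P v" by blast
        then show ?thesis by (intro image_eqI[of _ _ "u + v"]) (simp_all add: cvec.lin_add)
      qed
      show "csmul c x \<in> ?P ` supp m" if "x \<in> ?P ` supp m" for c x
      proof -
        from that obtain u where "u \<in> supp m" "x = ?P u" by blast
        then show ?thesis
          by (intro image_eqI[of _ _ "csmul c u"]) (simp_all add: lin_csmul[OF vector_space_csmul])
      qed
    qed
    have basis: "basis_vec i \<in> ?P ` supp m" if "i \<in> {1..m}" for i
      using that
    \<comment> \<open>Induction on the distance to the largest weight: the basis vectors of larger
      weight are already in the image, and subtracting them from \<open>b i\<close> leaves a nonzero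
      multiple of the \<open>i\<close>-th one.\<close>
    proof (induction "Max (r ` {1..m}) - r i" arbitrary: i rule: less_induct)
      case less
      have i: "i \<in> {1..m}" by fact
      have rest: "csmul (b i k) (basis_vec k) \<in> ?P ` supp m" if k: "k \<in> {1..m} - {i}" for k
      proof (cases "b i k = 0")
        case True
        then show ?thesis using cvec.subspace_0[OF sub] by (simp add: csmul_def zero_fun_def)
      next
        case False
        then have "r i < r k" using tri i k by auto
        moreover have "r k \<le> Max (r ` {1..m})" using k by simp
        ultimately have "Max (r ` {1..m}) - r k < Max (r ` {1..m}) - r i"
          by (intro diff_less_mono2) simp_all
        then have "basis_vec k \<in> ?P ` supp m" using less.hyps[of k] k by blast
        then show ?thesis by (rule cvec.subspace_scale[OF sub])
      qed
      have "b i = lin csmul basis_vec m (b i)" using b[OF i] lin_self by simp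
      also have "\<dots> = csmul (b i i) (basis_vec i) + (\<Sum>k\<in>{1..m}-{i}. csmul (b i k) (basis_vec k))"
        unfolding lin_def using i by (intro sum.remove) simp_all
      finally have "csmul (b i i) (basis_vec i) = b i - (\<Sum>k\<in>{1..m}-{i}. csmul (b i k) (basis_vec k))"
        using eq_diff_eq by metis
      moreover have "b i \<in> ?P ` supp m"
        using i lin_basis_vec[OF vector_space_csmul, of i m b]
        by (intro image_eqI[of _ _ "basis_vec i"]) simp_all
      ultimately have "csmul (b i i) (basis_vec i) \<in> ?P ` supp m"
        using cvec.subspace_diff[OF sub] cvec.subspace_sum[OF sub, of "{1..m} - {i}"] rest by simp
      then have "csmul (1 / b i i) (csmul (b i i) (basis_vec i)) \<in> ?P ` supp m"
        by (rule cvec.subspace_scale[OF sub])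
      then show ?case using diag[OF i] by simp
    qed
    have "(\<Sum>k=1..m. csmul (v k) (basis_vec k)) \<in> ?P ` supp m"
      by (intro cvec.subspace_sum[OF sub] cvec.subspace_scale[OF sub] basis)
    then have "lin csmul basis_vec m v \<in> ?P ` supp m"
      by (simp only: lin_def[of csmul basis_vec])
    then show ?thesis using that lin_self by simp
  qed
  ultimately show ?thesis by (auto simp: bij_betw_def)
qed

section \<open>The two extensions are not isomorphic\<close>

text \<open>Matrix units: each coordinate of a table is a combination of a few of them, so the
  double sum defining a product collapses to a few terms.\<close>

definition unit_mat :: "nat \<Rightarrow> nat \<Rightarrow> nat \<Rightarrow> nat \<Rightarrow> complex" where
  "unit_mat a b i j = (if i = a \<and> j = b then 1 else 0)"

lemma sum_unit_mat:
  fixes u v :: "nat \<Rightarrow> complex"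
  assumes "a \<in> {1..m}" "b \<in> {1..m}"
  shows "(\<Sum>i=1..m. \<Sum>j=1..m. u i * v j * unit_mat a b i j) = u a * v b"
    "(\<Sum>i=1..m. \<Sum>j=1..m. u i * v j * (c * unit_mat a b i j)) = c * u a * v b"
proof -
  have *: "(\<Sum>i=1..m. \<Sum>j=1..m. u i * v j * (c * unit_mat a b i j)) = c * u a * v b" for c
  proof -
    have "(\<Sum>i=1..m. \<Sum>j=1..m. u i * v j * (c * unit_mat a b i j)) =
        (\<Sum>i=1..m. if i = a then (\<Sum>j=1..m. if j = b then u a * v b * c else 0) else 0)"
      by (intro sum.cong refl)
        (use assms in \<open>simp add: unit_mat_def if_distrib[of "\<lambda>x. _ * x"] cong: if_cong\<close>)
    then show ?thesis using assms by simp
  qed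
  then show "(\<Sum>i=1..m. \<Sum>j=1..m. u i * v j * (c * unit_mat a b i j)) = c * u a * v b" .
  show "(\<Sum>i=1..m. \<Sum>j=1..m. u i * v j * unit_mat a b i j) = u a * v b"
    using *[of 1] by simp
qed

text \<open>The parameter \<open>c\<close> is the coefficient of \<open>e_2\<close> in
  \<open>[x, e_1]\<close>; the values 0 and 1 give the two algebras, which can then be treated
  together.\<close>

definition ext_table :: "nat \<Rightarrow> complex \<Rightarrow> nat \<Rightarrow> nat \<Rightarrow> nat \<Rightarrow> complex" where
  "ext_table n c i j =
     (if i = 1 \<and> j = n + 1 then basis_vec 1 - basis_vec (n - 1)
      else if 2 \<le> i \<and> i \<le> n - 2 \<and> j = n + 1 then csmul (of_nat (i - 1)) (basis_vec i)
      else if i = n \<and> j = n + 1 then basis_vec n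
      else if i = n + 1 \<and> j = 1 then - basis_vec 1 + csmul c (basis_vec 2) + basis_vec (n - 1)
      else if i = n + 1 \<and> j = n then - basis_vec n
      else nil_table n i j)"

lemma ext_table_R: "ext_table n 0 = R1_table n" "ext_table n 1 = R2_table n"
  by (intro ext; simp only: ext_table_def R1_table_def R2_table_def cvec.scale_zero_left cvec.scale_one add_0_right)+

text \<open>The product of the nilpotent algebra, one coordinate at a time. The right factor enters
  only through its coordinates 1 and \<open>n - 1\<close>.\<close>

definition nil_bracket :: "nat \<Rightarrow> (nat \<Rightarrow> complex) \<Rightarrow> (nat \<Rightarrow> complex) \<Rightarrow> nat \<Rightarrow> complex" where
  "nil_bracket n u v k =
     (if k = 2 then (u 1 + u (n - 1)) * v 1
      else if 3 \<le> k \<and> k \<le> n - 2 then u (k - 1) * v 1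
      else if k = n then u (n - 1) * v 1 - u 1 * v (n - 1)
      else 0)"

text \<open>Together with \<open>n = p + 5\<close>, the form \<open>k = q + 3\<close> removes
  truncated subtraction, so that comparisons such as \<open>k \<le> n - 2\<close> can be decided by
  simplification.\<close>

lemma index_cases:
  fixes k n :: nat
  assumes "n \<ge> 5"
  shows "k = 0 \<or> k = 1 \<or> k = 2 \<or> (\<exists>q. k = q + 3 \<and> q + 3 \<le> n - 2) \<or> k = n - 1 \<or> k = n \<or> n < k"
proof (cases "3 \<le> k \<and> k \<le> n - 2")
  case True
  then have "k = (k - 3) + 3" "(k - 3) + 3 \<le> n - 2" by auto
  then show ?thesis by blast
next
  case False
  then show ?thesis using assms by auto
qed

lemma nil_table_apply:
  assumes "n \<ge> 5"
  shows "nil_table n i j k =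
     (if k = 2 then unit_mat 1 1 i j + unit_mat (n - 1) 1 i j
      else if 3 \<le> k \<and> k \<le> n - 2 then unit_mat (k - 1) 1 i j
      else if k = n then unit_mat (n - 1) 1 i j - unit_mat 1 (n - 1) i j
      else 0)"
proof -
  obtain p where p: "n = p + 5"
    using assms le_Suc_ex by (metis add.commute)
  consider "j = 1" | "j = n - 1" | "j \<noteq> 1" "j \<noteq> n - 1" by blast
  then show ?thesis
  proof cases
    case 1
    consider "1 \<le> i" "i \<le> n - 3" | "i = n - 1" | "\<not> (1 \<le> i \<and> i \<le> n - 3)" "i \<noteq> n - 1" by blast
    then show ?thesis
      by cases (use 1 in \<open>auto simp: p nil_table_def basis_vec_apply unit_mat_def\<close>)
  next
    case 2
    then show ?thesis by (simp add: p nil_table_def basis_vec_apply unit_mat_def)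
  next
    case 3
    then show ?thesis by (simp add: nil_table_def unit_mat_def)
  qed
qed

text \<open>The bound \<open>m\<close> may exceed \<open>n\<close> because the same table is also
  summed over the \<open>n + 1\<close> indices of an extension.\<close>

lemma nil_table_bracket:
  assumes n: "n \<ge> 5" and m: "m \<ge> n"
  shows "(\<Sum>i=1..m. \<Sum>j=1..m. u i * v j * nil_table n i j k) = nil_bracket n u v k"
proof -
  obtain p where p: "n = p + 5"
    using n le_Suc_ex by (metis add.commute)
  consider "k = 0" | "k = 1" | "k = 2" | q where "k = q + 3" "q + 3 \<le> n - 2" | "k = n - 1" | "k = n" | "n < k"
    using index_cases[OF n] by metis
  then show ?thesis
    unfolding nil_table_apply[OF n] nil_bracket_def
    by cases (use m in \<open>simp_all del: One_nat_def 
        add: p distrib_left distrib_right right_diff_distrib sum.distrib sum_subtractf sum_unit_mat\<close>)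
qed

lemma ext_table_apply:
  assumes "n \<ge> 5"
  shows "ext_table n c i j k = 
     (if k = 1 then unit_mat 1 (n + 1) i j - unit_mat (n + 1) 1 i j
      else if k = 2 then nil_table n i j k + unit_mat 2 (n + 1) i j + c * unit_mat (n + 1) 1 i j
      else if 3 \<le> k \<and> k \<le> n - 2 then nil_table n i j k + of_nat (k - 1) * unit_mat k (n + 1) i j
      else if k = n - 1 then unit_mat (n + 1) 1 i j - unit_mat 1 (n + 1) i j
      else if k = n then nil_table n i j k + unit_mat n (n + 1) i j - unit_mat (n + 1) n i j
      else 0)"
proof -
  obtain p where p: "n = p + 5"
    using assms le_Suc_ex by (metis add.commute)
  consider "j = n + 1" | "i = n + 1" "j \<noteq> n + 1" | "i \<noteq> n + 1" "j \<noteq> n + 1" by blast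
  then show ?thesis
  proof cases
    case 1
    have nil: "nil_table n i j = 0"
      using 1 by (simp add: nil_table_def p)
    consider "i = 1" | "i = 2" | "3 \<le> i" "i \<le> n - 2" | "i = n" 
      | "i \<noteq> 1" "i \<noteq> 2" "\<not> (3 \<le> i \<and> i \<le> n - 2)" "i \<noteq> n" by blast
    then show ?thesis
    proof cases
      case 3
      then obtain q where "i = q + 3" using le_Suc_ex by (metis add.commute)
      then show ?thesis using 1 3 nil by (auto simp: p ext_table_def basis_vec_apply unit_mat_def)
    next
      case 5
      then have "\<not> (2 \<le> i \<and> i \<le> n - 2)" by auto
      then have "ext_table n c i j = 0"
        using 1 5 assms nil by (auto simp: ext_table_def)
      moreover have "i \<noteq> k" if "3 \<le> k \<and> k \<le> n - 2"
        using that 5 by blast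
      ultimately show ?thesis
        using 1 5 assms nil by (simp add: unit_mat_def)
    qed (use 1 nil in \<open>simp_all add: p ext_table_def basis_vec_apply unit_mat_def\<close>)
  next
    case 2
    have nil: "nil_table n i j = 0"
      using 2 by (simp add: nil_table_def p)
    consider "j = 1" | "j = n" | "j \<noteq> 1" "j \<noteq> n" by blast
    then show ?thesis
      by cases (use 2 nil in \<open>simp_all add: p ext_table_def basis_vec_apply unit_mat_def\<close>)
  next
    case 3
    then have "ext_table n c i j = nil_table n i j" by (simp add: ext_table_def)
    moreover have "unit_mat a (n + 1) i j = 0" "unit_mat (n + 1) a i j = 0" for a
      using 3 by (simp_all add: unit_mat_def)
    moreover consider "k = 0" | "k = 1" | "k = 2" | q where "k = q + 3" "q + 3 \<le> n - 2" | "k = n - 1" | "k = n" | "n < k"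
      using index_cases[OF assms] by metis
    ultimately show ?thesis
      by cases (simp_all add: p nil_table_apply del: One_nat_def)
  qed
qed

lemma ext_table_bracket:
  assumes n: "n \<ge> 5"
  shows "bracket (table_algebra (n + 1) (ext_table n c)) u v k =
     (if k = 1 then u 1 * v (n + 1) - u (n + 1) * v 1
      else if k = 2 then (u 1 + u (n - 1) + c * u (n + 1)) * v 1 + u 2 * v (n + 1)
      else if 3 \<le> k \<and> k \<le> n - 2 then u (k - 1) * v 1 + of_nat (k - 1) * u k * v (n + 1)
      else if k = n - 1 then u (n + 1) * v 1 - u 1 * v (n + 1)
      else if k = n then u (n - 1) * v 1 - u 1 * v (n - 1) + u n * v (n + 1) - u (n + 1) * v n
      else 0)"
proof -
  obtain p where p: "n = p + 5"
    using n le_Suc_ex by (metis add.commute)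
  consider "k = 0" | "k = 1" | "k = 2" | q where "k = q + 3" "q + 3 \<le> n - 2" | "k = n - 1" | "k = n" | "n < k"
    using index_cases[OF n] by metis
  then show ?thesis
    unfolding table_bracket_apply ext_table_apply[OF n]
    by cases (simp_all del: One_nat_def add: p distrib_left distrib_right right_diff_distrib
        sum.distrib sum_subtractf sum_unit_mat nil_table_bracket nil_bracket_def)
qed

lemma R1_not_isomorphic_R2:
  assumes n: "n \<ge> 5"
  shows "\<not> R1_alg n \<cong> R2_alg n"
proof
  assume "R1_alg n \<cong> R2_alg n"
  then have iso: "table_algebra (n + 1) (ext_table n 0) \<cong> table_algebra (n + 1) (ext_table n 1)" 
    (is "?A \<cong> ?B") by (simp add: R1_alg_def R2_alg_def ext_table_R)
  obtain f where f: "bij_betw f (supp (n + 1)) (supp (n + 1))" 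
      "\<And>c x. x \<in> supp (n + 1) \<Longrightarrow> f (csmul c x) = csmul c (f x)"
      "\<And>x y. x \<in> supp (n + 1) \<Longrightarrow> y \<in> supp (n + 1) \<Longrightarrow> f (bracket ?A x y) = bracket ?B (f x) (f y)"
    by (rule isomorphic_algE[OF iso, unfolded table_algebra_simps], rule that; assumption)
  define x where "x = basis_vec (n + 1)"
  define g where "g = basis_vec 1"
  define h where "h = basis_vec 1 - basis_vec (n - 1)"
  note defs = x_def g_def h_def
  have S: "x \<in> supp (n + 1)" "g \<in> supp (n + 1)" "h \<in> supp (n + 1)" "basis_vec 2 \<in> supp (n + 1)"
     "basis_vec 3 \<in> supp (n + 1)"
    using n by (auto simp: defs intro!: supp_diff)
  note br = ext_table_bracket[OF n]
  \<comment> \<open>The products \<open>- h\<close> and \<open>0\<close> are written as multiples of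
    \<open>h\<close>, because \<open>f\<close> is recorded as homogeneous and multiplicative and
    then carries all these relations over directly.\<close>
  have "bracket ?A h x k = h k \<and> bracket ?A x h k = csmul (- 1) h k \<and> bracket ?A h h k = csmul 0 h k
    \<and> bracket ?A g g k = basis_vec 2 k \<and> bracket ?A (basis_vec 2) h k = basis_vec 3 k" for k
  proof -
    obtain p where p: "n = p + 5"
      using n le_Suc_ex by (metis add.commute)
    consider "k = 0" | "k = 1" | "k = 2" | q where "k = q + 3" "q + 3 \<le> n - 2" | "k = n - 1" | "k = n" | "n < k"
      using index_cases[OF n] by metis
    then show ?thesis
      unfolding br by cases (simp_all del: One_nat_def add: p defs basis_vec_apply)
  qed
  then have hx: "bracket ?A h x = h" and xh: "bracket ?A x h = csmul (- 1) h" and hh: "bracket ?A h h = csmul 0 h"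
    and gg: "bracket ?A g g = basis_vec 2" and gh: "bracket ?A (basis_vec 2) h = basis_vec 3"
    unfolding fun_eq_iff by blast+
  define X G H Z where "X = f x" and "G = f g" and "H = f h" and "Z = bracket ?B G G"
  have HX: "bracket ?B H X = H" and XH: "bracket ?B X H = csmul (- 1) H" and HH: "bracket ?B H H = csmul 0 H"
    and Z: "Z = f (basis_vec 2)" and ZH: "bracket ?B Z H = f (basis_vec 3)"
    by (simp_all only: Z_def X_def G_def H_def f(2)[OF S(3), symmetric] f(3)[OF S(3) S(1), symmetric]
        f(3)[OF S(1) S(3), symmetric] f(3)[OF S(3) S(3), symmetric] f(3)[OF S(2) S(2), symmetric]
        hx xh hh gg gh f(3)[OF S(4) S(3), symmetric])
  \<comment> \<open>The index comparisons that occur when products are evaluated at the coordinates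
    \<open>n - 1\<close>, \<open>n\<close> and \<open>n + 1\<close>.\<close>
  have cn: "(n = 1) = False" "(n = 2) = False" "(n \<le> n - 2) = False" "(n = n - 1) = False"
    "(n - 1 = 1) = False" "(n - 1 = 2) = False" "(n - 1 \<le> n - 2) = False" "(3 \<le> n - 2) = True"
    "(n + 1 \<le> n - 2) = False" "(n + 1 = 1) = False" "(n + 1 = 2) = False" "(n + 1 = n - 1) = False"
    "(n + 1 = n) = False"
    using n by auto
  have Hx: "H (n + 1) = 0"
    using fun_cong[OF HX, of "n + 1"] unfolding br cn by simp
  \<comment> \<open>If \<open>H 1\<close> vanished, \<open>[[G, G], H]\<close> would be 0, against
    \<open>[[g, g], h] = e_3\<close> in the first algebra.\<close>
  have H1: "H 1 \<noteq> 0"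
  proof
    assume 0: "H 1 = 0"
    \<comment> \<open>The coordinates 1, \<open>n - 1\<close> and \<open>n\<close> of a product are
      antisymmetric in the two factors, so they vanish on a square; no product has an
      \<open>x\<close> component.\<close>
    have Z0: "Z 1 = 0" "Z (n - 1) = 0" "Z n = 0" "Z (n + 1) = 0"
      unfolding Z_def br cn by simp_all
    have "bracket ?B Z H = 0"
      by (simp del: One_nat_def add: fun_eq_iff br Z0 Hx 0)
    also have "0 = f (csmul 0 (basis_vec 3))"
      by (simp only: f(2)[OF S(5)]) (simp add: fun_eq_iff)
    finally have "f (basis_vec 3) = f (csmul 0 (basis_vec 3))"
      using ZH by simp
    then have "basis_vec 3 = csmul 0 (basis_vec 3)"
      using inj_onD[OF bij_betw_imp_inj_on[OF f(1)]] S by simp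
    from fun_cong[OF this, of 3] show False by (simp add: basis_vec_apply)
  qed
  have "H 1 * X (n + 1) = H 1"
    using fun_cong[OF HX, of 1] unfolding br Hx cn by simp
  then have X1: "X (n + 1) = 1" using H1 by simp
  have Hm: "H (n - 1) = - H 1"
    using fun_cong[OF HX, of "n - 1"] unfolding br Hx cn X1 by simp
  have "- H 1 * X 1 - H 1 * X (n - 1) = 0"
    using fun_cong[OF HX, of n] unfolding br Hx cn X1 Hm by simp
  then have "H 1 * (X 1 + X (n - 1)) = 0" by algebra
  then have X2: "X 1 + X (n - 1) = 0" using H1 by simp
  \<comment> \<open>Coordinate 3 exists as part of the chain \<open>e_2, ..., e_{n-2}\<close>
    because \<open>n \<ge> 5\<close>.\<close>
  have "H 2 * H 1 = 0"
    using fun_cong[OF HH, of 3] unfolding br Hx cn by simp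
  then have H2: "H 2 = 0" using H1 by simp
  \<comment> \<open>The summand 1 is the coefficient of \<open>e_2\<close> in
    \<open>[x, e_1]\<close> in the second table; it is what produces the contradiction.\<close>
  have "(X 1 + X (n - 1) + 1) * H 1 = 0"
    using fun_cong[OF XH, of 2] unfolding br Hx cn X1 by (simp add: algebra_simps H2)
  then show False unfolding X2 using H1 by simp
qed

section \<open>One-dimensional extensions of the nilpotent algebra\<close>

declare One_nat_def [simp del]

abbreviation e :: "nat \<Rightarrow> nat \<Rightarrow> complex" where "e \<equiv> basis_vec"

text \<open>The condition \<open>T_supp\<close> includes \<open>i = j = n + 1\<close>: every
  product, also \<open>[x, x]\<close>, lies in the nilpotent ideal.\<close>

locale nil_extension =
  fixes n :: nat and T :: "nat \<Rightarrow> nat \<Rightarrow> nat \<Rightarrow> complex"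
  assumes n: "n \<ge> 5"
    and T_supp: "\<And>i j. i \<in> {1..n+1} \<Longrightarrow> j \<in> {1..n+1} \<Longrightarrow> T i j \<in> supp n"
    and T_nil: "\<And>i j. i \<in> {1..n} \<Longrightarrow> j \<in> {1..n} \<Longrightarrow> T i j = nil_table n i j"
    and leibniz: "leibniz_id (table_algebra (n + 1) T)"
begin

definition br :: "(nat \<Rightarrow> complex) \<Rightarrow> (nat \<Rightarrow> complex) \<Rightarrow> nat \<Rightarrow> complex" where
  "br = bracket (table_algebra (n + 1) T)"

abbreviation x :: "nat \<Rightarrow> complex" where "x \<equiv> e (n + 1)"

text \<open>Comparisons valid for all \<open>n \<ge> 5\<close>. The equation
  \<open>n - 2 = 3\<close> is left open, since it holds exactly for \<open>n = 5\<close>.\<close>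

lemma n_simps [simp]:
  "(n = 0) = False" "(n = 1) = False" "(n = 2) = False" "(n = 3) = False" "(n = n - 1) = False" "(n = n - 2) = False"
  "(0 = n) = False" "(1 = n) = False" "(2 = n) = False" "(3 = n) = False" "(n - 1 = n) = False" "(n - 2 = n) = False"
  "(n - 1 = 0) = False" "(n - 1 = 1) = False" "(n - 1 = 2) = False" "(n - 1 = 3) = False" "(n - 1 = n - 2) = False"
  "(0 = n - 1) = False" "(1 = n - 1) = False" "(2 = n - 1) = False" "(3 = n - 1) = False" "(n - 2 = n - 1) = False"
  "(n - 2 = 0) = False" "(n - 2 = 1) = False" "(n - 2 = 2) = False"
  "(0 = n - 2) = False" "(1 = n - 2) = False" "(2 = n - 2) = False"
  "(n \<le> n - 1) = False" "(n \<le> n - 2) = False" "(n - 1 \<le> n - 2) = False"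
  "(1 \<le> n) = True" "(2 \<le> n) = True" "(1 \<le> n - 1) = True" "(2 \<le> n - 1) = True" "(3 \<le> n) = True"
  "(1 \<le> n - 2) = True" "(2 \<le> n - 2) = True" "(3 \<le> n - 2) = True" "(3 \<le> n - 1) = True"
  "(n + 1 = n) = False" "(n + 1 = n - 1) = False" "(n + 1 = n - 2) = False" "(n + 1 = 1) = False" "(n + 1 = 2) = False"
  "(n = n + 1) = False" "(n - 1 = n + 1) = False" "(n - 2 = n + 1) = False" "(1 = n + 1) = False" "(2 = n + 1) = False"
  "(n + 1 \<le> n) = False" "(n + 1 \<le> n - 2) = False" "(n - 2 < n - 1) = True" "(n - 2 < n) = True" "(n - 1 < n) = True"
  using n by auto

lemma br_bilinear:
  "br (u + v) w = br u w + br v w" "br w (u + v) = br w u + br w v"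
  "br (csmul c u) w = csmul c (br u w)" "br w (csmul c u) = csmul c (br w u)"
  by (simp_all add: br_def table_bracket_bilinear)

lemma br_zero [simp]: "br 0 u = 0" "br u 0 = 0"
  using br_bilinear(3)[of 0 0 u] br_bilinear(4)[of u 0 0] by simp_all

lemma br_uminus: "br (- u) w = - br u w" "br w (- u) = - br w u"
  using br_bilinear(1)[of u "- u" w] br_bilinear(2)[of w u "- u"]
  by (simp_all add: eq_neg_iff_add_eq_0 add.commute)

lemma br_diff: "br (u - v) w = br u w - br v w" "br w (u - v) = br w u - br w v"
  using br_bilinear(1)[of u "- v" w] br_bilinear(2)[of w u "- v"] by (simp_all add: br_uminus)

lemma br_sum: "br (\<Sum>i\<in>I. f i) w = (\<Sum>i\<in>I. br (f i) w)" "br w (\<Sum>i\<in>I. f i) = (\<Sum>i\<in>I. br w (f i))"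
  for I :: "nat set"
proof -
  have "br (sum f I) w = (\<Sum>i\<in>I. br (f i) w) \<and> br w (sum f I) = (\<Sum>i\<in>I. br w (f i))"
    by (induction I rule: infinite_finite_induct)
      (simp_all only: sum.infinite sum.empty sum.insert br_zero br_bilinear simp_thms)
  then show "br (sum f I) w = (\<Sum>i\<in>I. br (f i) w)" "br w (sum f I) = (\<Sum>i\<in>I. br w (f i))" by auto
qed

lemma br_supp [simp]: "br u v \<in> supp n"
  unfolding br_def by (rule table_bracket_supp) (rule T_supp)

lemma br_basis: "i \<in> {1..n+1} \<Longrightarrow> j \<in> {1..n+1} \<Longrightarrow> br (e i) (e j) = T i j"
  unfolding br_def by (rule table_bracket_basis)

lemma br_leibniz: "br u (br v w) = br (br u v) w - br (br u w) v"
proof -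
  \<comment> \<open>The product ignores coordinates outside \<open>{1..n+1}\<close>, so truncating
    the arguments extends the Leibniz identity from the carrier to all functions.\<close>
  define t :: "(nat \<Rightarrow> complex) \<Rightarrow> nat \<Rightarrow> complex" where "t u k = (if k \<in> {1..n+1} then u k else 0)" for u k
  have t: "t u \<in> supp (n + 1)" "br (t u) v = br u v" "br u (t v) = br u v" for u v
    by (auto simp: t_def supp_def br_def fun_eq_iff table_bracket_apply intro!: sum.cong)
  have "br (t u) (br (t v) (t w)) = br (br (t u) (t v)) (t w) - br (br (t u) (t w)) (t v)"
    using leibniz t(1) unfolding leibniz_id_def br_def table_algebra_simps by blast
  then show ?thesis by (simp add: t(2,3))
qed

lemma br_nil:
  assumes "u \<in> supp n" "v \<in> supp n"
  shows "br u v = nil_bracket n u v"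
proof
  fix k
  have "br u v k = (\<Sum>i=1..n+1. \<Sum>j=1..n+1. u i * v j * nil_table n i j k)"
    unfolding br_def table_bracket_apply
  proof (intro sum.cong refl)
    fix i j assume "i \<in> {1..n+1}" "j \<in> {1..n+1}"
    then show "u i * v j * T i j k = u i * v j * nil_table n i j k"
      using T_nil[of i j] supp_outside[OF assms(1), of i] supp_outside[OF assms(2), of j]
      by (cases "i \<in> {1..n} \<and> j \<in> {1..n}") auto
  qed
  then show "br u v k = nil_bracket n u v k"
    using nil_table_bracket[OF n, of "n + 1"] by simp
qed

lemma nil_bracket_supp [simp]: "u \<in> supp n \<Longrightarrow> v \<in> supp n \<Longrightarrow> nil_bracket n u v \<in> supp n"
  using br_supp[of u v] by (simp only: br_nil)

lemma nil_bracket_at [simp]: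
  "nil_bracket n u v 2 = (u 1 + u (n - 1)) * v 1"
  "nil_bracket n u v n = u (n - 1) * v 1 - u 1 * v (n - 1)"
  "nil_bracket n u v 3 = u 2 * v 1"
  "nil_bracket n u v 1 = 0" "nil_bracket n u v 0 = 0"
  "nil_bracket n u v (n - 1) = 0"
  by (simp_all add: nil_bracket_def)

lemma nil_bracket_mid: "3 \<le> k \<Longrightarrow> k \<le> n - 2 \<Longrightarrow> nil_bracket n u v k = u (k - 1) * v 1"
  by (auto simp add: nil_bracket_def)

lemma ext_coords:
  assumes "u \<in> supp n" "v \<in> supp n" "u 1 = v 1" "u 2 = v 2"
    "\<And>k. 3 \<le> k \<Longrightarrow> k \<le> n - 2 \<Longrightarrow> u k = v k" "u (n - 1) = v (n - 1)" "u n = v n"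
  shows "u = v"
proof
  fix k
  show "u k = v k"
    using index_cases[OF n, of k] assms(3-) supp_outside[OF assms(1), of k] supp_outside[OF assms(2), of k]
    by force
qed

lemma br_expand:
  assumes "u \<in> supp n"
  shows "br u w = (\<Sum>k=1..n. csmul (u k) (br (e k) w))" "br w u = (\<Sum>k=1..n. csmul (u k) (br w (e k)))"
proof -
  have "u = (\<Sum>k=1..n. csmul (u k) (e k))"
    using lin_self[OF assms] by (simp add: lin_def)
  then have "br u w = br (\<Sum>k=1..n. csmul (u k) (e k)) w" "br w u = br w (\<Sum>k=1..n. csmul (u k) (e k))"
    by simp_all
  then show "br u w = (\<Sum>k=1..n. csmul (u k) (br (e k) w))" "br w u = (\<Sum>k=1..n. csmul (u k) (br w (e k)))"
    by (simp_all add: br_sum br_bilinear)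
qed

lemma nil_products:
  "br (e 1) (e 1) = e 2" "br (e (n - 1)) (e 1) = e n + e 2" "br (e 1) (e (n - 1)) = - e n"
  "br (e (n - 1)) (e (n - 1)) = 0" "br (e n) (e 1) = 0"
  "2 \<le> i \<Longrightarrow> i \<le> n - 3 \<Longrightarrow> br (e i) (e 1) = e (i + 1)"
proof -
  have "(1 \<le> n - 3) = True" "(n - 1 \<le> n - 3) = False" "(n \<le> n - 3) = False" using n by auto
  then show "br (e 1) (e 1) = e 2" "br (e (n - 1)) (e 1) = e n + e 2" "br (e 1) (e (n - 1)) = - e n"
  "br (e (n - 1)) (e (n - 1)) = 0" "br (e n) (e 1) = 0"
  "2 \<le> i \<Longrightarrow> i \<le> n - 3 \<Longrightarrow> br (e i) (e 1) = e (i + 1)"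
    by (auto simp: br_basis T_nil nil_table_def)
qed

text \<open>With equal last two arguments the right side of the Leibniz identity cancels, so squares
  and their polarizations \<open>[v, w] + [w, v]\<close> lie in the right annihilator.\<close>

lemma br_square: "br u (br v v) = 0" "br u (br v w + br w v) = 0"
  by (simp_all add: br_bilinear br_leibniz)

text \<open>The vector \<open>e_2\<close> is the square of \<open>e_1\<close>. Once
  \<open>[e_1, e_i] = 0\<close> is known, \<open>e_{i+1} = [e_i, e_1] + [e_1, e_i]\<close> is again
  a polarized square.\<close>

lemma br_mid_basis: "2 \<le> i \<Longrightarrow> i \<le> n - 2 \<Longrightarrow> br u (e i) = 0"
proof (induction i arbitrary: u rule: nat_induct_at_least)
  case base
  show ?case using br_square(1)[of u "e 1"] by (simp add: nil_products)
next
  case (Suc i)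
  have i: "2 \<le> i" "i \<le> n - 3" using Suc n by auto
  have "br (e 1) (e i) = 0"
    by (rule Suc.IH) (use Suc in auto)
  then show ?case using br_square(2)[of u "e i" "e 1"] nil_products(6)[OF i]
    by (simp add: Suc_eq_plus1)
qed

lemma br_mid:
  assumes "u \<in> supp n" "u 1 = 0" "u (n - 1) = 0" "u n = 0"
  shows "br w u = 0"
proof -
  have "csmul (u k) (br w (e k)) = 0" if "k \<in> {1..n}" for k
  proof -
    have "k = 1 \<or> k = n - 1 \<or> k = n \<or> 2 \<le> k \<and> k \<le> n - 2"
      using that by auto
    then show ?thesis using br_mid_basis[of k w] assms by auto
  qed
  then show ?thesis unfolding br_expand(2)[OF assms(1)] by (intro sum.neutral ballI)
qed

lemma e_supp [simp]: "e 1 \<in> supp n" "e 2 \<in> supp n" "e (n - 1) \<in> supp n" "e n \<in> supp n" "e (n - 2) \<in> supp n"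
  using n by simp_all

lemma e_apply [simp]: "e 1 1 = 1" "e 1 (n - 1) = 0" "e 1 2 = 0" "e 1 n = 0" "e (n - 1) 1 = 0" "e (n - 1) 2 = 0"
  "e (n - 1) n = 0" "e (n - 1) (n - 1) = 1" "e n 1 = 0" "e n 2 = 0" "e n (n - 1) = 0" "e n n = 1"
  "e 2 1 = 0" "e 2 2 = 1" "e 2 (n - 1) = 0" "e 2 n = 0"
  by (simp_all add: basis_vec_apply)

section \<open>The derivation given by right multiplication with \<open>x\<close>\<close>

lemma right_derivation: "br (br u v) w = br (br u w) v + br u (br v w)"
  by (simp add: br_leibniz)

text \<open>The vectors \<open>e_1\<close> and \<open>e_{n-1}\<close> generate the nilpotent
  algebra, so these five products determine all products with \<open>x\<close>.\<close>

definition "d = br (e 1) x"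
definition "m = br (e (n - 1)) x"
definition "p = br x (e 1)"
definition "q = br x (e (n - 1))"
definition "s = br x x"

lemma dmpq_supp [simp]: "d \<in> supp n" "m \<in> supp n" "p \<in> supp n" "q \<in> supp n" "s \<in> supp n"
  by (simp_all add: d_def m_def p_def q_def s_def)

text \<open>The derivation is applied to \<open>[e_{n-1}, e_{n-1}] = 0\<close> and coordinate 2 is
  read off.\<close>

lemma m_1: "m 1 = 0"
proof -
  have "0 = br (br (e (n - 1)) (e (n - 1))) x" by (simp add: nil_products)
  also have "\<dots> = nil_bracket n m (e (n - 1)) + nil_bracket n (e (n - 1)) m"
    by (simp only: right_derivation m_def[symmetric]) (simp add: br_nil)
  finally have "0 = (nil_bracket n m (e (n - 1)) + nil_bracket n (e (n - 1)) m) 2" by (simp only: zero_fun_apply)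
  then show ?thesis by simp
qed

lemma D_n: "br (e n) x = csmul (d 1 + m (n - 1)) (e n)"
proof -
  have "br (e n) x = - br (br (e 1) (e (n - 1))) x"
    by (simp add: nil_products br_uminus)
  also have "\<dots> = - (nil_bracket n d (e (n - 1)) + nil_bracket n (e 1) m)"
    by (simp only: right_derivation d_def[symmetric] m_def[symmetric]) (simp add: br_nil)
  also have "\<dots> = csmul (d 1 + m (n - 1)) (e n)"
  proof (rule ext_coords)
    show "- (nil_bracket n d (e (n - 1)) + nil_bracket n (e 1) m) \<in> supp n"
      by simp
  qed (auto simp: m_1 nil_bracket_mid basis_vec_apply)
  finally show ?thesis .
qed

lemma D_2: "br (e 2) x = nil_bracket n d (e 1) + nil_bracket n (e 1) d"
  using right_derivation[of "e 1" "e 1" x]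
  by (simp add: nil_products d_def[symmetric] br_nil)

text \<open>The derivation is applied to \<open>[e_{n-1}, e_1] = e_n + e_2\<close>. Coordinate 2
  relates the eigenvalues; the later coordinates of the chain compare \<open>m\<close> with
  \<open>d\<close>.\<close>

lemma d_m: "m (n - 1) = d 1 + d (n - 1)" "2 \<le> k \<Longrightarrow> k \<le> n - 3 \<Longrightarrow> m k = d k"
proof -
  have "br (e n) x + br (e 2) x = nil_bracket n m (e 1) + nil_bracket n (e (n - 1)) d"
    using right_derivation[of "e (n - 1)" "e 1" x]
    by (simp add: nil_products d_def[symmetric] m_def[symmetric] br_nil br_bilinear)
  then have *: "(csmul (d 1 + m (n - 1)) (e n) + (nil_bracket n d (e 1) + nil_bracket n (e 1) d)) j =
      (nil_bracket n m (e 1) + nil_bracket n (e (n - 1)) d) j" for j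
    by (simp only: D_2 D_n)
  show "m (n - 1) = d 1 + d (n - 1)" using *[of 2] by (simp add: m_1)
  show "m k = d k" if "2 \<le> k" "k \<le> n - 3"
  proof -
    have "3 \<le> k + 1" "k + 1 \<le> n - 2" "k + 1 \<noteq> n" "k \<noteq> n - 1" using that n by auto
    then show ?thesis using *[of "k + 1"] that by (simp add: nil_bracket_mid basis_vec_apply)
  qed
qed

text \<open>The sums \<open>q + m\<close> and \<open>p + d\<close> are polarized squares, hence
  killed by left multiplication with \<open>e_1\<close>; that multiplication detects exactly the
  coordinates 1 and \<open>n - 1\<close>.\<close>

lemma q_1: "q 1 = 0" "q (n - 1) = - m (n - 1)"
  and p_1: "p 1 = - d 1" "p (n - 1) = - d (n - 1)"
proof -
  have "nil_bracket n (e 1) (q + m) = 0" "nil_bracket n (e 1) (p + d) = 0"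
    using br_square(2)[of "e 1" x "e (n - 1)"] br_square(2)[of "e 1" x "e 1"]
    by (simp_all add: q_def[symmetric] m_def[symmetric] p_def[symmetric] d_def[symmetric] br_nil)
  then have "nil_bracket n (e 1) (q + m) j = 0" "nil_bracket n (e 1) (p + d) j = 0" for j
    by simp_all
  from this(1)[of 2] this(1)[of n] this(2)[of 2] this(2)[of n] show "q 1 = 0" "q (n - 1) = - m (n - 1)" "p 1 = - d 1" "p (n - 1) = - d (n - 1)"
    by (simp_all add: m_1 eq_neg_iff_add_eq_0 add.commute neg_eq_iff_add_eq_0)
qed

lemma L_n: "br x (e n) = nil_bracket n q (e 1) - nil_bracket n p (e (n - 1))"
proof -
  have "br x (e n) = - br x (br (e 1) (e (n - 1)))"
    by (simp add: nil_products br_uminus)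
  also have "\<dots> = - (br p (e (n - 1)) - br q (e 1))"
    by (simp only: br_leibniz p_def[symmetric] q_def[symmetric])
  finally show ?thesis by (simp add: br_nil)
qed

text \<open>Expanding \<open>[x, [e_n, e_1]] = 0\<close> forces the eigenvalue of \<open>[\<cdot>, x]\<close> on \<open>e_{n-1}\<close> to vanish.\<close>

lemma m_top: "m (n - 1) = 0"
proof -
  have "0 = br x (br (e n) (e 1))" by (simp add: nil_products)
  also have "\<dots> = nil_bracket n (br x (e n)) (e 1) - nil_bracket n p (e n)"
    by (simp only: br_leibniz p_def[symmetric]) (simp add: br_nil)
  \<comment> \<open>Coordinate 3 is the coefficient of \<open>e_2\<close> in
    \<open>[x, e_n]\<close>, which equals \<open>q 1 + q (n - 1) = - m (n - 1)\<close>.\<close>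
  finally have "(nil_bracket n (br x (e n)) (e 1) - nil_bracket n p (e n)) 3 = 0"
    by simp
  then show ?thesis by (simp add: L_n q_1)
qed

lemma d_top: "d (n - 1) = - d 1"
  using d_m(1) m_top by (simp add: eq_neg_iff_add_eq_0 add.commute)

text \<open>From \<open>e_{i+1} = [e_i, e_1]\<close>, the image of \<open>e_{i+1}\<close> is
  \<open>[D e_i, e_1] + [e_i, d]\<close>: the first term shifts the previous image by one place, the
  second adds \<open>d 1\<close> on the diagonal. The eigenvalue starts at \<open>d 1\<close> on
  \<open>e_2\<close>, not at twice this value, because \<open>d (n - 1) = - d 1\<close>.\<close>

lemma D_mid:
  "2 \<le> i \<Longrightarrow> i \<le> n - 2 \<Longrightarrow> br (e i) x =
    (\<lambda>k. if k = i then of_nat (i - 1) * d 1 else if i < k \<and> k \<le> n - 2 then d (k - i + 1) else 0)"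
proof (induction i rule: nat_induct_at_least)
  case base
  show ?case unfolding D_2
  proof (rule ext_coords)
    fix k assume "3 \<le> k" "k \<le> n - 2"
    moreover from this have "k - 2 + 1 = k - 1" "k - 1 \<noteq> 1" by auto
    ultimately show "(nil_bracket n d (e 1) + nil_bracket n (e 1) d) k =
      (if k = 2 then of_nat (2 - 1) * d 1 else if 2 < k \<and> k \<le> n - 2 then d (k - 2 + 1) else 0)"
      by (simp add: nil_bracket_mid basis_vec_apply)
  next
    show "nil_bracket n d (e 1) + nil_bracket n (e 1) d \<in> supp n"
      by simp
  qed (auto simp: d_top supp_def)
next
  case (Suc i)
  let ?f = "\<lambda>k. if k = i then of_nat (i - 1) * d 1 else if i < k \<and> k \<le> n - 2 then d (k - i + 1) else 0"
  have i: "2 \<le> i" "i \<le> n - 3" "i \<le> n - 2" "1 \<le> i" "i \<le> n" using Suc n by auto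
  have IH: "br (e i) x = ?f" by (rule Suc.IH) (rule i)
  have s: "e i \<in> supp n" "?f \<in> supp n" using i n br_supp[of "e i" x] by (auto simp: IH)
  have "br (e (i + 1)) x = nil_bracket n ?f (e 1) + nil_bracket n (e i) d"
    using right_derivation[of "e i" "e 1" x] nil_products(6)[OF i(1,2)]
    by (simp add: IH d_def[symmetric] br_nil s(2) i(4,5))
  also have "\<dots> = (\<lambda>k. if k = i + 1 then of_nat (i + 1 - 1) * d 1 else if i + 1 < k \<and> k \<le> n - 2 then d (k - (i + 1) + 1) else 0)"
  proof (rule ext_coords)
    fix k assume "3 \<le> k" "k \<le> n - 2"
    then obtain l where "k = l + 1" "2 \<le> l" "l + 1 \<le> n - 2" using le_Suc_ex[of 1 k] by (metis Suc_eq_plus1 add_le_cancel_right le_add_diff_inverse2 numeral_3_eq_3 numeral_2_eq_2 one_add_one Suc_le_D Suc_le_mono)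
    then show "(nil_bracket n ?f (e 1) + nil_bracket n (e i) d) k =
      (if k = i + 1 then of_nat (i + 1 - 1) * d 1 else if i + 1 < k \<and> k \<le> n - 2 then d (k - (i + 1) + 1) else 0)"
      using i by (auto simp: nil_bracket_mid basis_vec_apply algebra_simps of_nat_diff)
  next
    show "nil_bracket n ?f (e 1) + nil_bracket n (e i) d \<in> supp n"
      by (simp add: s(2) i(4,5))
  qed (use i in \<open>auto simp: supp_def basis_vec_apply\<close>)
  finally show ?case by (simp only: Suc_eq_plus1)
qed

lemma D_n': "br (e n) x = csmul (d 1) (e n)"
  using D_n m_top by simp

text \<open>The filtration by right multiplications: for \<open>k \<ge> 3\<close> this is the span of \<open>e_k, \<dots>, e_{n-2}\<close>,
  and for \<open>k = 2\<close> it also contains \<open>e_n\<close>.\<close>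

definition F :: "nat \<Rightarrow> (nat \<Rightarrow> complex) set" where
  "F k = {u \<in> supp n. u 1 = 0 \<and> u (n - 1) = 0 \<and> (\<forall>j. 2 \<le> j \<and> j < k \<and> j \<le> n - 2 \<longrightarrow> u j = 0) \<and>
    (3 \<le> k \<longrightarrow> u n = 0)}"

lemma F_subspace: "cvec.subspace (F k)"
  by (auto simp: cvec.subspace_def F_def)

lemmas F_closed = cvec.subspace_0[OF F_subspace] cvec.subspace_add[OF F_subspace]
  cvec.subspace_diff[OF F_subspace] cvec.subspace_scale[OF F_subspace] cvec.subspace_sum[OF F_subspace]
  cvec.subspace_neg[OF F_subspace]

lemma F_supp: "u \<in> F k \<Longrightarrow> u \<in> supp n"
  by (simp add: F_def)

lemma F_top: "F (n - 1) = {0}"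
proof -
  have "u = 0" if "u \<in> F (n - 1)" for u
    by (rule ext_coords) (use that n in \<open>auto simp: F_def\<close>)
  then show ?thesis using F_closed(1) by blast
qed

lemma D_mid_F:
  assumes "2 \<le> k" "k \<le> n - 2"
  shows "br (e k) x - csmul (of_nat (k - 1) * d 1) (e k) \<in> F (k + 1)"
proof -
  have "br (e k) x - csmul (of_nat (k - 1) * d 1) (e k) \<in> supp n"
    using assms by (intro supp_diff supp_csmul) auto
  then show ?thesis using assms
    by (auto simp: F_def D_mid basis_vec_apply)
qed

lemma nil_bracket_F:
  "u \<in> supp n \<Longrightarrow> w \<in> supp n \<Longrightarrow> nil_bracket n u w \<in> F 2"
  "u \<in> F k \<Longrightarrow> 2 \<le> k \<Longrightarrow> w \<in> supp n \<Longrightarrow> nil_bracket n u w \<in> F (k + 1)"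
proof -
  show "nil_bracket n u w \<in> F 2" if "u \<in> supp n" "w \<in> supp n"
    using nil_bracket_supp[OF that] by (auto simp: F_def)
  show "nil_bracket n u w \<in> F (k + 1)" if "u \<in> F k" "2 \<le> k" "w \<in> supp n"
  proof -
    have "nil_bracket n u w j = 0" if j: "2 \<le> j" "j < k + 1" "j \<le> n - 2" for j
    proof (cases "j = 2")
      case True
      then show ?thesis using \<open>u \<in> F k\<close> by (simp add: F_def)
    next
      case False
      then have "3 \<le> j" "2 \<le> j - 1" "j - 1 < k" "j - 1 \<le> n - 2" using j by auto
      then show ?thesis using \<open>u \<in> F k\<close> j by (simp add: F_def nil_bracket_mid)
    qed
    then show ?thesis using nil_bracket_supp[of u w] that by (auto simp: F_def)
  qed
qed

lemma supp_split:
  assumes "w \<in> supp (n + 1)"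
  obtains w' c where "w' \<in> supp n" "w = w' + csmul c x"
proof
  show "w(n + 1 := 0) \<in> supp n" "w = w(n + 1 := 0) + csmul (w (n + 1)) x"
    using assms by (auto simp: supp_def fun_eq_iff basis_vec_apply le_Suc_eq)
qed

text \<open>With \<open>d 1 = 0\<close> all diagonal entries of \<open>[\<cdot>, x]\<close> vanish,
  so right multiplication by any element sends \<open>F k\<close> into \<open>F (k + 1)\<close>, and
  the filtration reaches 0 at \<open>n - 1\<close>.\<close>

lemma nilpotent_case:
  assumes d0: "d 1 = 0"
  shows "nilpotent_alg (table_algebra (n + 1) T)"
proof -
  let ?A = "table_algebra (n + 1) T"
  have D_F2: "br u x \<in> F 2" if "u \<in> supp n" for u
    unfolding br_expand(1)[OF that]
  proof (intro F_closed)
    fix k assume "k \<in> {1..n}"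
    then have "k = 1 \<or> k = n - 1 \<or> k = n \<or> 2 \<le> k \<and> k \<le> n - 2"
      by auto
    then show "br (e k) x \<in> F 2"
    proof (elim disjE conjE)
      assume "k = 1" then show ?thesis using d0 d_top dmpq_supp(1) by (auto simp: F_def d_def)
    next
      assume "k = n - 1" then show ?thesis using m_1 m_top dmpq_supp(2) by (auto simp: F_def m_def)
    next
      assume "k = n" then show ?thesis by (simp add: D_n' d0 F_closed)
    next
      assume "2 \<le> k" "k \<le> n - 2"
      then have "br (e k) x \<in> F (k + 1)" using D_mid_F[of k] d0 by simp
      then show ?thesis using \<open>2 \<le> k\<close> by (auto simp: F_def)
    qed
  qed
  have D_F: "br u x \<in> F (k + 1)" if u: "u \<in> F k" and k: "2 \<le> k" for u k
    unfolding br_expand(1)[OF F_supp[OF u]]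
  proof (rule F_closed(5))
    fix j assume "j \<in> {1..n}"
    then consider "j = 1 \<or> j = n - 1" | "j = n" | "2 \<le> j" "j < k" "j \<le> n - 2" | "2 \<le> j" "k \<le> j" "j \<le> n - 2"
      by force
    then show "csmul (u j) (br (e j) x) \<in> F (k + 1)"
    proof cases
      case 1
      then show ?thesis using u by (auto simp: F_def)
    next
      case 2
      then show ?thesis by (simp add: D_n' d0 F_closed)
    next
      case 3
      then show ?thesis using u by (simp add: F_def)
    next
      case 4
      then have "br (e j) x \<in> F (j + 1)" using D_mid_F[of j] d0 by simp
      then have "br (e j) x \<in> F (k + 1)" using 4 k by (auto simp: F_def)
      then show ?thesis by (rule F_closed)
    qed
  qed
  have br_F2: "br u w \<in> F 2" if "u \<in> supp n" "w \<in> supp (n + 1)" for u w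
  proof (rule supp_split[OF that(2)])
    fix w' c assume w: "w' \<in> supp n" "w = w' + csmul c x"
    have "br u w = nil_bracket n u w' + csmul c (br u x)"
      using that(1) w by (simp add: br_bilinear br_nil)
    then show ?thesis using nil_bracket_F(1)[OF that(1) w(1)] D_F2[OF that(1)] by (simp add: F_closed)
  qed
  have br_F: "br u w \<in> F (k + 1)" if "u \<in> F k" "2 \<le> k" "w \<in> supp (n + 1)" for u w k
  proof (rule supp_split[OF that(3)])
    fix w' c assume w: "w' \<in> supp n" "w = w' + csmul c x"
    have "br u w = nil_bracket n u w' + csmul c (br u x)"
      using F_supp[OF that(1)] w by (simp add: br_bilinear br_nil)
    then show ?thesis using nil_bracket_F(2)[OF that(1,2) w(1)] D_F[OF that(1,2)] by (simp add: F_closed)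
  qed
  have prod: "product_space ?A U (supp (n + 1)) \<subseteq> S"
    if "\<And>u w. u \<in> U \<Longrightarrow> w \<in> supp (n + 1) \<Longrightarrow> br u w \<in> S" "cvec.subspace S" for U S
    unfolding product_space_def table_algebra_simps
    by (rule cvec.span_minimal) (use that in \<open>auto simp: br_def\<close>)
  have lc1: "lower_central ?A (Suc 0) \<subseteq> supp n"
    unfolding lower_central.simps table_algebra_simps by (rule prod) (simp_all add: subspace_supp)
  \<comment> \<open>The indexing starts at 0: term 1 of the series lies in the nilpotent ideal and
    term 2 in \<open>F 2\<close>, and from there both indices advance together.\<close>
  have lc: "lower_central ?A k \<subseteq> F k" if "2 \<le> k" for k
    using that
  proof (induction k rule: nat_induct_at_least)
    case base
    have "lower_central ?A (Suc (Suc 0)) \<subseteq> F 2"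
      unfolding lower_central.simps(2)[of _ "Suc 0"] table_algebra_simps
      by (rule prod) (use lc1 br_F2 F_subspace in auto)
    then show ?case by (simp add: numeral_2_eq_2)
  next
    case (Suc k)
    have "lower_central ?A (Suc k) \<subseteq> F (k + 1)"
      unfolding lower_central.simps(2) table_algebra_simps
      by (rule prod) (use Suc br_F F_subspace in auto)
    then show ?case by (simp only: Suc_eq_plus1)
  qed
  have "0 \<in> lower_central ?A (Suc (n - 2))"
    unfolding lower_central.simps(2) product_space_def table_algebra_simps by (rule cvec.span_zero)
  moreover have "Suc (n - 2) = n - 1" using n by simp
  ultimately have "lower_central ?A (n - 1) = {0}"
    using lc[of "n - 1"] F_top by auto
  then show ?thesis unfolding nilpotent_alg_def by blast
qed

section \<open>Diagonalization\<close>

text \<open>On \<open>F k\<close> with \<open>k \<ge> 2\<close> the derivation is triangular with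
  eigenvalues \<open>k - 1, ..., n - 3\<close>, and for \<open>k = 2\<close> also 1 on
  \<open>e_n\<close>. All are nonzero, so the equation is solved from the lowest coordinate
  upwards.\<close>

lemma D_solve:
  assumes d1: "d 1 = 1" and "2 \<le> k" "k \<le> n - 1" "w \<in> F k"
  shows "\<exists>v\<in>F k. br v x = w"
  using assms(2-)
proof (induction "n - 1 - k" arbitrary: k w)
  case 0
  then have "k = n - 1" by simp
  then have "w = 0" using 0 F_top by simp
  then show ?case using F_closed(1) br_zero(1) by metis
next
  case (Suc j)
  then have k: "2 \<le> k" "k \<le> n - 2" by auto
  \<comment> \<open>The first summand matches coordinate \<open>k\<close>. The second removes the
    \<open>e_n\<close> part at once, as the remainder must lie in \<open>F (k + 1)\<close>, where
    that coordinate is 0.\<close>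
  define v0 where "v0 = csmul (w k / of_nat (k - 1)) (e k) + csmul (w n) (e n)"
  have w: "w \<in> supp n" using Suc by (simp add: F_supp)
  have kn: "k \<noteq> n" "k \<noteq> n - 1" "k \<noteq> 1" "1 \<le> k" "k \<le> n" using k by auto
  have k1: "of_nat (k - 1) \<noteq> (0 :: complex)" using k by simp
  have v0: "v0 \<in> F k"
    using Suc.prems kn k by (auto simp: v0_def F_def basis_vec_apply)
  define y where "y = br (e k) x - csmul (of_nat (k - 1) * d 1) (e k)"
  have y: "y \<in> F (k + 1)" unfolding y_def using k by (rule D_mid_F)
  have "br v0 x = csmul (w k / of_nat (k - 1)) (br (e k) x) + csmul (w n) (e n)"
    by (simp add: v0_def br_bilinear D_n' d1)
  moreover have "br (e k) x = csmul (of_nat (k - 1)) (e k) + y"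
    by (simp add: y_def d1)
  ultimately have v0x: "br v0 x = csmul (w k / of_nat (k - 1)) (csmul (of_nat (k - 1)) (e k) + y) + csmul (w n) (e n)"
    by (simp only:)
  have br0: "br v0 x = csmul (w k) (e k) + csmul (w k / of_nat (k - 1)) y + csmul (w n) (e n)"
  proof -
    have "w k / of_nat (k - 1) * of_nat (k - 1) = w k" using k1 by simp
    then show ?thesis unfolding v0x by (simp only: cvec.scale_right_distrib cvec.scale_scale)
  qed
  have "w - csmul (w k) (e k) - csmul (w n) (e n) \<in> F (k + 1)"
    using Suc.prems kn k by (auto simp: F_def basis_vec_apply less_Suc_eq)
  then have "w - csmul (w k) (e k) - csmul (w n) (e n) - csmul (w k / of_nat (k - 1)) y \<in> F (k + 1)"
    using y by (rule F_closed(3)[OF _ F_closed(4)])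
  then have "w - br v0 x \<in> F (k + 1)"
    unfolding br0 by (simp only: diff_diff_eq add_ac)
  moreover have "j = n - 1 - (k + 1)" "2 \<le> k + 1" "k + 1 \<le> n - 1" using Suc k by auto
  ultimately obtain v1 where v1: "v1 \<in> F (k + 1)" "br v1 x = w - br v0 x"
    using Suc.hyps(1) by blast
  have "v1 \<in> F k" using v1(1) k by (auto simp: F_def)
  then show ?case using v0 v1(2) by (intro bexI[of _ "v0 + v1"]) (simp_all add: F_closed br_bilinear)
qed

text \<open>If \<open>e\<^sub>1 - e_{n-1}\<close> and \<open>e_{n-1}\<close> are corrected to eigenvectors of \<open>[\<cdot>, x]\<close> for the eigenvalues
  1 and 0, then \<open>[\<cdot>, x]\<close> becomes diagonal on the basis which they generate.\<close>

lemma diagonalize: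
  assumes d1: "d 1 = 1"
  obtains T' where "nil_extension n T'" "table_algebra (n + 1) T \<cong> table_algebra (n + 1) T'"
    "T' 1 (n + 1) = e 1 - e (n - 1)" "T' (n - 1) (n + 1) = 0"
proof -
  have "- m \<in> F 2" using m_1 m_top by (auto simp: F_def)
  \<comment> \<open>Chosen so that \<open>e_{n-1} + v\<close> is annihilated by the
    derivation.\<close>
  then obtain v where v: "v \<in> F 2" "br v x = - m"
    using D_solve[OF d1, of 2] n by auto
  have v_supp: "v \<in> supp n" and v1: "v 1 = 0" and vn: "v (n - 1) = 0"
    using v(1) by (auto simp: F_def)
  \<comment> \<open>The difference \<open>d - m\<close> deviates from \<open>e_1 - e_{n-1}\<close>
    only in \<open>e_{n-2}\<close> and \<open>e_n\<close>. Adding \<open>t e_{n-2}\<close> to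
    \<open>e_1\<close> corrects the former if \<open>d (n - 2) - m (n - 2) + (n - 3) t = t\<close>,
    which is solvable since \<open>n \<noteq> 4\<close>.\<close>
  define t where "t = - (d (n - 2) - m (n - 2)) / of_nat (n - 4)"
  \<comment> \<open>Since \<open>[b_1, e_{n-1}] = - e_n\<close>, adding \<open>c e_{n-1}\<close> to
    \<open>x\<close> removes the deviation in \<open>e_n\<close>.\<close>
  define c where "c = d n - m n"
  \<comment> \<open>The middle vectors are the products generated by \<open>b 1\<close>:
    \<open>b 2\<close> is its square and \<open>b (i + 1) = [b i, b 1]\<close>, which shifts the
    coordinates of \<open>v\<close>. The term \<open>t e_{n-2}\<close> leaves no trace there,
    because \<open>[e_{n-2}, e_1] = 0\<close>.\<close>
  define b :: "nat \<Rightarrow> nat \<Rightarrow> complex" where "b i =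
    (if i = 1 then e 1 + csmul t (e (n - 2)) + v
     else if i = n - 1 then e (n - 1) + v
     else if i = n then e n
     else if i = n + 1 then x + csmul c (e (n - 1))
     else (\<lambda>k. if k = i then 1 else if i < k \<and> k \<le> n - 2 then v (k - i + 1) else 0))" for i
  have b_special: "b 1 = e 1 + csmul t (e (n - 2)) + v" "b (n - 1) = e (n - 1) + v" "b n = e n"
      "b (n + 1) = x + csmul c (e (n - 1))"
    by (simp_all add: b_def)
  have b_mid: "b i = (\<lambda>k. if k = i then 1 else if i < k \<and> k \<le> n - 2 then v (k - i + 1) else 0)"
    if "2 \<le> i" "i \<le> n - 2" for i
    using that unfolding b_def by auto
  have b_supp: "b i \<in> supp n" if "i \<in> {1..n}" for i
  proof -
    have "i = 1 \<or> i = n - 1 \<or> i = n \<or> 2 \<le> i \<and> i \<le> n - 2" using that by auto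
    then show ?thesis
    proof (elim disjE conjE)
      assume "2 \<le> i" "i \<le> n - 2"
      then show ?thesis by (auto simp: b_mid supp_def)
    qed (use v_supp in \<open>simp_all add: b_special\<close>)
  qed
  have b_supp': "b i \<in> supp (n + 1)" if "i \<in> {1..n+1}" for i
  proof (cases "i = n + 1")
    case True
    then show ?thesis using n by (auto simp: b_special intro!: supp_add supp_csmul)
  next
    case False
    then show ?thesis using that by (intro supp_mono[OF b_supp]) auto
  qed
  \<comment> \<open>The new basis is triangular for the order
    \<open>x, e_1, e_{n-1}, e_2, ..., e_{n-2}, e_n\<close>.\<close>
  let ?r = "\<lambda>i. if i = n + 1 then 0 else if i = 1 then 1 else if i = n - 1 then 2 else if i = n then n + 5 else i + 2"
  have bij: "bij_betw (lin csmul b (n + 1)) (supp (n + 1)) (supp (n + 1))"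
  proof (rule triangular_bij[where r = ?r])
    fix i assume i: "i \<in> {1..n+1}"
    then have cases: "i = 1 \<or> i = n - 1 \<or> i = n \<or> i = n + 1 \<or> 2 \<le> i \<and> i \<le> n - 2" by auto
    show "b i \<in> supp (n + 1)" using i by (rule b_supp')
    show "b i i \<noteq> 0" using cases
      by (elim disjE conjE) (simp_all add: b_special b_mid v1 vn basis_vec_apply)
    fix k assume k: "k \<in> {1..n+1}" "k \<noteq> i" "b i k \<noteq> 0"
    show "?r i < ?r k" using cases
    proof (elim disjE conjE)
      assume i: "i = 1"
      then have "k \<noteq> n + 1" using k supp_outside[OF b_supp[of 1], of "n + 1"] by auto
      moreover have "k \<noteq> 1" using k i by simp
      ultimately show ?thesis using i by auto
    next
      assume i: "i = n - 1"
      then have "k \<noteq> n + 1" using k supp_outside[OF b_supp[of "n - 1"], of "n + 1"] by auto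
      moreover have "k \<noteq> 1" "k \<noteq> n - 1" using k i by (auto simp: b_special v1)
      ultimately show ?thesis using i k by auto
    next
      assume "i = n"
      then show ?thesis using k by (simp add: b_special basis_vec_apply)
    next
      assume "i = n + 1"
      then show ?thesis using k by (auto simp: b_special basis_vec_apply)
    next
      assume i: "2 \<le> i" "i \<le> n - 2"
      then have "i < k" "k \<le> n - 2" using k by (auto simp: b_mid split: if_splits)
      then show ?thesis using i by auto
    qed
  qed
  let ?A = "table_algebra (n + 1) T"
  have "bilinear_alg ?A"
    by (rule bilinear_table_algebra) (rule supp_mono[OF T_supp], simp_all)
  moreover have "bij_betw (lin (smul ?A) b (n + 1)) (supp (n + 1)) (carr ?A)"
    using bij by simp
  ultimately obtain T' where T': "?A \<cong> table_algebra (n + 1) T'"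
    "\<And>i j. i \<in> {1..n+1} \<Longrightarrow> j \<in> {1..n+1} \<Longrightarrow> T' i j \<in> supp (n + 1)"
    "\<And>i j. i \<in> {1..n+1} \<Longrightarrow> j \<in> {1..n+1} \<Longrightarrow> lin csmul b (n + 1) (T' i j) = br (b i) (b j)"
    by (rule basis_iso) (unfold table_algebra_simps br_def, blast)
  have lin_b: "lin csmul b (n + 1) (e i) = b i" if "i \<in> {1..n+1}" for i
    using that by (intro lin_basis_vec vector_space_csmul) auto
  \<comment> \<open>Coordinates in the basis \<open>b\<close> are unique, so an entry of
    \<open>T'\<close> is identified by multiplying the basis vectors.\<close>
  have T'_eq: "T' i j = w" if "i \<in> {1..n+1}" "j \<in> {1..n+1}" "w \<in> supp (n + 1)"
      "br (b i) (b j) = lin csmul b (n + 1) w" for i j w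
    using inj_onD[OF bij_betw_imp_inj_on[OF bij]] T'(2,3)[OF that(1,2)] that(3,4) by simp
  have T'_supp: "T' i j \<in> supp n" if ij: "i \<in> {1..n+1}" "j \<in> {1..n+1}" for i j
  proof -
    \<comment> \<open>Only \<open>b (n + 1)\<close> has an \<open>x\<close> component, and it equals
      1; hence the last entry of \<open>T' i j\<close> is the \<open>x\<close> component of a
      product, which is 0.\<close>
    have "(\<Sum>k=1..n+1. T' i j k * b k (n + 1)) = (\<Sum>k=1..n+1. if k = n + 1 then T' i j k else 0)"
    proof (intro sum.cong refl)
      fix k assume k: "k \<in> {1..n+1}"
      show "T' i j k * b k (n + 1) = (if k = n + 1 then T' i j k else 0)"
      proof (cases "k = n + 1")
        case True
        then show ?thesis by (simp add: b_special basis_vec_apply)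
      next
        case False
        then show ?thesis using supp_outside[OF b_supp[of k], of "n + 1"] k by auto
      qed
    qed
    then have "T' i j (n + 1) = lin csmul b (n + 1) (T' i j) (n + 1)"
      by (simp add: lin_csmul_apply)
    also have "\<dots> = 0" unfolding T'(3)[OF ij] by (rule supp_outside[OF br_supp]) simp
    finally have "T' i j (n + 1) = 0" .
    moreover have "k = n + 1 \<or> k \<notin> {1..n+1}" if "k \<notin> {1..n}" for k
      using that by auto
    ultimately show ?thesis using T'(2)[OF ij] unfolding supp_def by blast
  qed
  have n4: "of_nat (n - 4) \<noteq> (0 :: complex)" "of_nat (n - 3) = (of_nat (n - 4) + 1 :: complex)"
  proof -
    have "n - 4 \<noteq> 0" "n - 3 = n - 4 + 1" using n by auto
    then show "of_nat (n - 4) \<noteq> (0 :: complex)" "of_nat (n - 3) = (of_nat (n - 4) + 1 :: complex)"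
      by (simp_all only: of_nat_eq_0_iff of_nat_add of_nat_1 not_False_eq_True)
  qed
  have b1x: "br (b 1) (b (n + 1)) = b 1 - b (n - 1)"
  proof -
    have "br (e (n - 2)) x = csmul (of_nat (n - 3)) (e (n - 2))"
      using n by (simp add: D_mid d1 fun_eq_iff basis_vec_apply)
    then have "br (b 1) x = d + csmul (t * of_nat (n - 3)) (e (n - 2)) - m"
      by (simp add: b_special br_bilinear d_def[symmetric] v(2))
    moreover have "br (b 1) (e (n - 1)) = - e n"
      using b_supp[of 1]
      by (intro ext_coords) (auto simp: br_nil nil_bracket_mid basis_vec_apply b_special v1 vn)
    ultimately have "br (b 1) (b (n + 1)) = d + csmul (t * of_nat (n - 3)) (e (n - 2)) - m - csmul c (e n)"
      by (simp add: b_special(4) br_bilinear)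
    also have "\<dots> = b 1 - b (n - 1)"
    proof (rule ext_coords)
      have 2: "d k = m k" if "2 \<le> k" "k \<le> n - 2" "k \<noteq> n - 2" for k
        using d_m(2)[of k] that by simp
      have *: "d (n - 2) + t * of_nat (n - 3) - m (n - 2) = t"
      proof -
        have "t * of_nat (n - 4) = - (d (n - 2) - m (n - 2))"
          unfolding t_def by (rule nonzero_eq_divide_eq[OF n4(1), THEN iffD1]) (rule refl)
        then show ?thesis unfolding n4(2) by algebra
      qed
      show "(d + csmul (t * of_nat (n - 3)) (e (n - 2)) - m - csmul c (e n)) 2 = (b 1 - b (n - 1)) 2"
        using 2[of 2] n by (simp add: b_special basis_vec_apply)
      show "(d + csmul (t * of_nat (n - 3)) (e (n - 2)) - m - csmul c (e n)) k = (b 1 - b (n - 1)) k"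
        if "3 \<le> k" "k \<le> n - 2" for k
        using that 2[of k] * by (auto simp: b_special basis_vec_apply)
    qed (use n in \<open>simp_all add: b_special v_supp d1 m_1 m_top d_top c_def basis_vec_apply\<close>)
    finally show ?thesis .
  qed
  have bnx: "br (b (n - 1)) (b (n + 1)) = 0"
  proof -
    have "br (b (n - 1)) x = 0" by (simp add: b_special br_bilinear m_def[symmetric] v(2))
    moreover have "br (b (n - 1)) (e (n - 1)) = 0"
      using b_supp[of "n - 1"]
      by (intro ext_coords) (auto simp: br_nil nil_bracket_mid basis_vec_apply b_special v1 vn)
    ultimately show ?thesis by (simp add: b_special(4) br_bilinear)
  qed
  have b_nil: "br (b i) (b j) = lin csmul b (n + 1) (nil_table n i j)" if ij: "i \<in> {1..n}" "j \<in> {1..n}" for i j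
  proof -
    have br_b: "br (b i) (b j) = nil_bracket n (b i) (b j)"
      using ij by (intro br_nil b_supp)
    have n3: "(1 \<le> n - 3) = True" "(n - 1 \<le> n - 3) = False" "(n \<le> n - 3) = False" using n by auto
    \<comment> \<open>A right factor whose coordinates 1 and \<open>n - 1\<close> vanish gives
      product 0, so only the two generators remain to be examined.\<close>
    have j_cases: "j = 1 \<or> j = n - 1 \<or> b j 1 = 0 \<and> b j (n - 1) = 0 \<and> j \<noteq> 1 \<and> j \<noteq> n - 1"
    proof -
      have "j = 1 \<or> j = n - 1 \<or> j = n \<or> 2 \<le> j \<and> j \<le> n - 2" using ij by auto
      then show ?thesis by (auto simp: b_special b_mid)
    qed
    have i_cases: "i = 1 \<or> i = n - 1 \<or> i = n \<or> i = n - 2 \<or> 2 \<le> i \<and> i \<le> n - 3" using ij by auto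
    show ?thesis using j_cases
    proof (elim disjE conjE)
      assume "b j 1 = 0" "b j (n - 1) = 0" "j \<noteq> 1" "j \<noteq> n - 1"
      moreover from this have "br (b i) (b j) = 0"
        unfolding br_b by (simp add: fun_eq_iff nil_bracket_def)
      ultimately show ?thesis by (simp add: nil_table_def cvec.lin_zero)
    next
      assume j: "j = n - 1"
      have "b i 1 = (if i = 1 then 1 else 0)"
        using i_cases n v1 by (auto simp: b_special b_mid basis_vec_apply)
      then have "br (b i) (b j) = (if i = 1 then - e n else 0)"
        unfolding br_b unfolding j using v1 vn
        by (auto simp: fun_eq_iff nil_bracket_def b_special basis_vec_apply)
      then show ?thesis using j n by (simp add: nil_table_def cvec.lin_zero cvec.lin_uminus lin_b b_special n3)
    next
      assume j: "j = 1"
      have nb: "nil_bracket n (b i) (b 1) \<in> supp n"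
        using ij b_supp by simp
      have b11: "b 1 1 = 1" "b 1 (n - 1) = 0" by (simp_all add: b_special v1 vn basis_vec_apply)
      have b2: "b 2 \<in> supp n" "b 2 1 = 0" "b 2 2 = 1" "b 2 (n - 1) = 0" "b 2 n = 0"
        "\<And>k. 3 \<le> k \<Longrightarrow> k \<le> n - 2 \<Longrightarrow> b 2 k = v (k - 1)"
        using b_supp[of 2] by (simp_all add: b_mid) (simp add: One_nat_def)
      have "nil_bracket n (b i) (b 1) = lin csmul b (n + 1) (nil_table n i 1)"
        using i_cases
      proof (elim disjE conjE)
        assume i: "i = 1"
        have "nil_bracket n (b 1) (b 1) = b 2"
        proof (rule ext_coords)
          show "nil_bracket n (b 1) (b 1) k = b 2 k" if "3 \<le> k" "k \<le> n - 2" for k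
          proof -
            have "k - 1 \<noteq> 1" "k - 1 \<noteq> n - 2" using that by auto
            then show ?thesis using that by (simp add: nil_bracket_mid b11 b2(6)) (simp add: b_special basis_vec_apply)
          qed
        qed (use nb i in \<open>simp_all add: b2 b11\<close>)
        then show ?thesis using i n by (simp add: nil_table_def n3 lin_b)
      next
        assume i: "i = n - 1"
        have "nil_bracket n (b (n - 1)) (b 1) = b n + b 2"
        proof (rule ext_coords)
          show "nil_bracket n (b (n - 1)) (b 1) k = (b n + b 2) k" if "3 \<le> k" "k \<le> n - 2" for k
          proof -
            have "k - 1 \<noteq> n - 1" "k \<noteq> n" using that by auto
            then show ?thesis using that by (simp add: nil_bracket_mid b11 b2(6)) (simp add: b_special basis_vec_apply)
          qed
        qed (use nb i in \<open>simp_all add: b2 b11 b_special v1 vn basis_vec_apply\<close>)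
        then show ?thesis using i n by (simp add: nil_table_def n3 lin_b cvec.lin_add)
      next
        assume i: "i = n"
        have "nil_bracket n (b n) (b 1) = 0"
        proof (rule ext_coords)
          show "nil_bracket n (b n) (b 1) k = 0 k" if "3 \<le> k" "k \<le> n - 2" for k
            using that by (auto simp: nil_bracket_mid b_special basis_vec_apply)
        qed (use nb i in \<open>simp_all add: b_special v1 vn basis_vec_apply\<close>)
        then show ?thesis using i by (simp add: nil_table_def n3 cvec.lin_zero)
      next
        assume i: "i = n - 2"
        have "nil_bracket n (b (n - 2)) (b 1) = 0"
        proof (rule ext_coords)
          show "nil_bracket n (b (n - 2)) (b 1) k = 0 k" if "3 \<le> k" "k \<le> n - 2" for k
            using that by (auto simp: nil_bracket_mid b_mid)
        qed (use nb i n in \<open>simp_all add: b_mid b11\<close>)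
        moreover have "\<not> n - 2 \<le> n - 3" using n by auto
        ultimately show ?thesis using i by (simp add: nil_table_def n3 cvec.lin_zero)
      next
        assume i: "2 \<le> i" "i \<le> n - 3"
        then have i': "i \<le> n - 2" "2 \<le> i + 1" "i + 1 \<le> n - 2" "i + 1 \<in> {1..n}" using n by auto
        have "nil_bracket n (b i) (b 1) = b (i + 1)"
        proof (rule ext_coords)
          show "nil_bracket n (b i) (b 1) k = b (i + 1) k" if "3 \<le> k" "k \<le> n - 2" for k
          proof -
            have "k - 1 = i \<longleftrightarrow> k = i + 1" "i < k - 1 \<longleftrightarrow> i + 1 < k" "k - 1 - i = k - (i + 1)" "k - 1 \<le> n - 2"
              using that by auto
            then show ?thesis using that i i' by (simp add: nil_bracket_mid b11 b_mid)
          qed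
        next
          show "b (i + 1) \<in> supp n" using i' by (intro b_supp)
        qed (use nb i i' in \<open>auto simp: b_mid b11\<close>)
        then show ?thesis using i i' n by (simp add: nil_table_def lin_b)
      qed
      then show ?thesis using br_b j by simp
    qed
  qed
  have nil_supp: "nil_table n i j \<in> supp n" if "i \<in> {1..n}" "j \<in> {1..n}" for i j
    using T_supp[of i j] T_nil[OF that] that by auto
  have "nil_extension n T'"
  proof
    show "leibniz_id (table_algebra (n + 1) T')"
      using T'(1) \<open>bilinear_alg ?A\<close> leibniz by (rule leibniz_id_transport)
    show "T' i j = nil_table n i j" if "i \<in> {1..n}" "j \<in> {1..n}" for i j
      using that by (intro T'_eq b_nil supp_mono[OF nil_supp]) auto
  qed (use n T'_supp in auto)
  moreover have "T' 1 (n + 1) = e 1 - e (n - 1)"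
    by (rule T'_eq) (use n in \<open>auto intro!: supp_diff simp: b1x cvec.lin_diff lin_b\<close>)
  moreover have "T' (n - 1) (n + 1) = 0"
    by (rule T'_eq) (use n in \<open>auto simp: bnx cvec.lin_zero\<close>)
  ultimately show ?thesis using that T'(1) by blast
qed

section \<open>The left multiplication by \<open>x\<close>\<close>

lemma mid_cases:
  assumes "k \<in> {1..n+1}"
  obtains "k = 1" | "k = n - 1" | "k = n" | "k = n + 1" | "2 \<le> k" "k \<le> n - 2" "k \<noteq> 1" "k \<noteq> n - 1" "k \<noteq> n" "k \<noteq> n + 1"
proof -
  have "k = 1 \<or> k = n - 1 \<or> k = n \<or> k = n + 1 \<or> 
      2 \<le> k \<and> k \<le> n - 2 \<and> k \<noteq> 1 \<and> k \<noteq> n - 1 \<and> k \<noteq> n \<and> k \<noteq> n + 1"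
    using assms by auto
  then show ?thesis using that by blast
qed

text \<open>After its components along \<open>e_1\<close>, \<open>e_{n-1}\<close> and
  \<open>e_n\<close> are removed, \<open>u\<close> lies in the span of
  \<open>e_2, ..., e_{n-2}\<close>, hence in the right annihilator.\<close>

lemma L_formula:
  assumes "u \<in> supp n"
  shows "br x u = csmul (u 1) p + csmul (u (n - 1)) q + csmul (u n) (br x (e n))"
proof -
  have "br x (u - csmul (u 1) (e 1) - csmul (u (n - 1)) (e (n - 1)) - csmul (u n) (e n)) = 0"
    by (rule br_mid) (use assms in simp_all)
  then show ?thesis
    by (simp add: br_diff br_bilinear p_def q_def algebra_simps)
qed

section \<open>Consequences of the normal form of the derivation\<close>

context
  assumes d_eq: "d = e 1 - e (n - 1)" and m_eq: "m = 0"
begin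

lemma d_1: "d 1 = 1"
  by (simp add: d_eq)

lemma D_mid': "2 \<le> i \<Longrightarrow> i \<le> n - 2 \<Longrightarrow> br (e i) x = csmul (of_nat (i - 1)) (e i)"
  by (auto simp: D_mid d_1 fun_eq_iff basis_vec_apply) (auto simp: d_eq basis_vec_apply)

text \<open>Away from coordinate \<open>n - 1\<close> the derivation acts diagonally; that
  coordinate is left out because \<open>e_1\<close> is sent to \<open>e_1 - e_{n-1}\<close>.\<close>

lemma D_formula:
  assumes "u \<in> supp n"
  shows "br u x 1 = u 1" "br u x n = u n" "2 \<le> k \<Longrightarrow> k \<le> n - 2 \<Longrightarrow> br u x k = of_nat (k - 1) * u k"
proof -
  have D: "br u x k = (\<Sum>i=1..n. u i * br (e i) x k)" for k
    by (simp add: br_expand(1)[OF assms] sum_fun_apply)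
  have *: "br u x k = c * u k" if k: "k \<in> {1..n}" "k \<noteq> n - 1" 
      and c: "c = (if k = 1 \<or> k = n then 1 else of_nat (k - 1))" for k c
  proof -
    have "br u x k = (\<Sum>i=1..n. if i = k then c * u k else 0)"
      unfolding D
    proof (intro sum.cong refl)
      fix i assume "i \<in> {1..n}"
      then have "i \<in> {1..n+1}" "i \<noteq> n + 1" by auto
      then show "u i * br (e i) x k = (if i = k then c * u k else 0)"
      proof (cases rule: mid_cases)
        case 1
        then show ?thesis using k(2) c by (auto simp: d_def[symmetric] d_eq basis_vec_apply)
      next
        case 2
        then show ?thesis using k(2) by (auto simp: m_def[symmetric] m_eq)
      next
        case 3
        then show ?thesis using c by (auto simp: D_n' d_1 basis_vec_apply)
      next
        case 5
        then show ?thesis using c by (auto simp: D_mid' basis_vec_apply)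
      qed simp
    qed
    then show ?thesis using k by simp
  qed
  show "br u x 1 = u 1" "br u x n = u n"
    using *[of 1 1] *[of n 1] by simp_all
  show "br u x k = of_nat (k - 1) * u k" if "2 \<le> k" "k \<le> n - 2"
  proof -
    have "k \<in> {1..n}" "k \<noteq> n - 1" "\<not> (k = 1 \<or> k = n)" using that by auto
    then show ?thesis using *[of k "of_nat (k - 1)"] by simp
  qed
qed

lemma L_n_top: "br x (e n) n = - 1"
  by (simp add: L_n q_1 m_top p_1 d_1)

text \<open>As \<open>m = 0\<close>, \<open>q\<close> itself is a polarized square, so
  \<open>[x, q] = 0\<close>. The Leibniz identity for \<open>[x, [x, e_{n-1}]]\<close> becomes
  \<open>[q, x] = [s, e_{n-1}]\<close>, a multiple of \<open>e_n\<close>. The nonzero eigenvalues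
  clear the middle of \<open>q\<close>, \<open>[x, q] = 0\<close> clears \<open>q n\<close>, and
  coordinate \<open>n\<close> then gives \<open>s 1 = 0\<close>.\<close>

lemma q_zero: "q = 0" and s_1: "s 1 = 0"
proof -
  have xq: "br x q = 0"
    using br_square(2)[of x x "e (n - 1)"] by (simp add: q_def m_def[symmetric] m_eq)
  moreover have "br x q = br s (e (n - 1)) - br q x"
    using br_leibniz[of x x "e (n - 1)"] by (simp add: q_def s_def)
  ultimately have Dq: "br q x = nil_bracket n s (e (n - 1))"
    by (simp add: br_nil)
  have q_mid: "q k = 0" if "2 \<le> k" "k \<le> n - 2" for k
  proof -
    have "of_nat (k - 1) * q k = nil_bracket n s (e (n - 1)) k"
      using D_formula(3)[of q k] that Dq by simp
    also have "\<dots> = 0" using that by (auto simp: nil_bracket_def)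
    finally show ?thesis using that by simp
  qed
  have "csmul (q n) (br x (e n)) = 0"
    using xq L_formula[of q] by (simp add: q_1 m_top)
  from fun_cong[OF this, of n] have qn: "q n = 0" by (simp add: L_n_top)
  show "q = 0"
  proof (rule ext_coords)
    show "q k = 0 k" if "3 \<le> k" "k \<le> n - 2" for k using that by (simp add: q_mid)
  qed (simp_all add: q_1 m_top qn q_mid)
  show "s 1 = 0"
    using D_formula(2)[of q] Dq qn by simp
qed

lemma L_n_eq: "br x (e n) = - e n"
  unfolding L_n q_zero
proof (rule ext_coords)
  show "(nil_bracket n 0 (e 1) - nil_bracket n p (e (n - 1))) k = (- e n) k" if "3 \<le> k" "k \<le> n - 2" for k
    using that by (auto simp: nil_bracket_mid basis_vec_apply)
qed (simp_all add: p_1 d_1)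

text \<open>The polarized square \<open>p + d\<close> is killed by \<open>[x, \<cdot>]\<close>, and
  \<open>[x, d] = p - q = p\<close>. Comparing \<open>[x, p] = - p\<close> with
  \<open>L_formula\<close> leaves only the term in \<open>p n\<close>.\<close>

lemma p_n: "p n = 0" and x_p: "br x p = - p"
proof -
  have "br x (p + d) = 0"
    using br_square(2)[of x x "e 1"] by (simp add: p_def d_def)
  then show xp: "br x p = - p"
    by (simp add: br_bilinear br_diff d_eq p_def[symmetric] q_def[symmetric] q_zero eq_neg_iff_add_eq_0)
  have "br x p = - p + csmul (p n) (- e n)"
    using L_formula[of p] by (simp add: p_1 d_1 q_zero L_n_eq)
  then have "csmul (p n) (- e n) = 0" using xp by simp
  from fun_cong[OF this, of n] show "p n = 0" by simp
qed

text \<open>The Leibniz identity for \<open>[x, [x, e_1]]\<close> reads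
  \<open>- p = [s, e_1] - [p, x]\<close>. Coordinate 2 gives \<open>s (n - 1) = 0\<close>;
  coordinate \<open>k\<close> gives \<open>- p k = s (k - 1) - (k - 1) p k\<close>. The last entry
  \<open>s n\<close> vanishes because \<open>s\<close> is a square.\<close>

lemma s_coords: "s (n - 1) = 0" "s n = 0" "3 \<le> k \<Longrightarrow> k \<le> n - 2 \<Longrightarrow> s (k - 1) = of_nat (k - 2) * p k"
proof -
  have "- p = br s (e 1) - br p x"
    using br_leibniz[of x x "e 1"] x_p by (simp add: p_def s_def)
  then have *: "- p k = nil_bracket n s (e 1) k - br p x k" for k
    by (simp add: br_nil fun_eq_iff)
  show sn: "s (n - 1) = 0"
    using *[of 2] D_formula(3)[of p 2] by (simp add: s_1)
  show "s (k - 1) = of_nat (k - 2) * p k" if k: "3 \<le> k" "k \<le> n - 2"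
  proof -
    have "of_nat (k - 1) = (of_nat (k - 2) + 1 :: complex)"
    proof -
      have "k - 1 = k - 2 + 1" using k by simp
      then show ?thesis by (simp only: of_nat_add of_nat_1)
    qed
    moreover have "- p k = s (k - 1) - of_nat (k - 1) * p k"
      using *[of k] D_formula(3)[of p k] k by (simp add: nil_bracket_mid)
    ultimately show ?thesis by algebra
  qed
  have "br x s = 0" unfolding s_def by (rule br_square)
  then have "csmul (s n) (- e n) = 0"
    using L_formula[of s] by (simp add: s_1 sn L_n_eq)
  from fun_cong[OF this, of n] show "s n = 0" by simp
qed

text \<open>The solution of \<open>[y, x] = s\<close> in the right annihilator. Replacing
  \<open>x\<close> by \<open>x - y\<close> preserves the right multiplication and makes the square
  of \<open>x\<close> zero.\<close>

definition "y = (\<lambda>k. if 2 \<le> k \<and> k \<le> n - 2 then s k / of_nat (k - 1) else 0)"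

lemma y_props: "y \<in> supp n" "y 1 = 0" "y (n - 1) = 0" "y n = 0"
  by (auto simp: y_def supp_def)

lemma br_y_right: "br w y = 0"
  by (rule br_mid) (rule y_props)+

lemma D_y: "br y x = s"
proof (rule ext_coords)
  have *: "br y x k = s k" if "2 \<le> k" "k \<le> n - 2" for k
    using D_formula(3)[OF y_props(1), of k] that by (simp add: y_def)
  show "br y x 2 = s 2" by (rule *) simp_all
  show "br y x k = s k" if "3 \<le> k" "k \<le> n - 2" for k using that by (intro *) simp_all
  have "br y x (n - 1) = (\<Sum>k=1..n. y k * br (e k) x (n - 1))"
    by (simp add: br_expand(1)[OF y_props(1)] sum_fun_apply)
  also have "\<dots> = 0"
  proof (intro sum.neutral ballI)
    fix k assume "k \<in> {1..n}"
    show "y k * br (e k) x (n - 1) = 0"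
      by (cases "2 \<le> k \<and> k \<le> n - 2") (auto simp: D_mid' basis_vec_apply y_def)
  qed
  finally show "br y x (n - 1) = s (n - 1)" by (simp add: s_coords)
qed (simp_all add: D_formula y_props s_1 s_coords)

definition "x' = x - y"

lemma x'_right: "br u x' = br u x"
  by (simp add: x'_def br_diff br_y_right)

lemma x'_left:
  "br x' (e 1) = csmul (p 2) (e 2) - e 1 + e (n - 1)"
  "br x' (e (n - 1)) = 0" "br x' (e n) = - e n" "2 \<le> i \<Longrightarrow> i \<le> n - 2 \<Longrightarrow> br x' (e i) = 0"
  "br x' x' = 0"
proof -
  have "p - nil_bracket n y (e 1) = csmul (p 2) (e 2) - e 1 + e (n - 1)"
  proof (rule ext_coords)
    show "(p - nil_bracket n y (e 1)) k = (csmul (p 2) (e 2) - e 1 + e (n - 1)) k" if k: "3 \<le> k" "k \<le> n - 2" for k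
    proof -
      have "2 \<le> k - 1" "k - 1 \<le> n - 2" "k - 1 - 1 = k - 2" "k \<noteq> 1" "k \<noteq> n - 1" using k by auto
      \<comment> \<open>The shift that kills \<open>[x, x]\<close> also clears
        \<open>[x, e_1]\<close> beyond \<open>e_2\<close>: dividing
        \<open>s (k - 1) = (k - 2) p k\<close> by the eigenvalue \<open>k - 2\<close> of
        \<open>e_{k-1}\<close> returns exactly \<open>p k\<close>.\<close>
      then have "y (k - 1) = of_nat (k - 2) * p k / of_nat (k - 2)" using s_coords(3)[OF k] by (simp only: y_def simp_thms if_True)
      moreover have "of_nat (k - 2) \<noteq> (0 :: complex)" unfolding of_nat_eq_0_iff using k by simp
      ultimately have "y (k - 1) = p k" by (metis nonzero_mult_div_cancel_left)
      then show ?thesis using k \<open>k \<noteq> 1\<close> \<open>k \<noteq> n - 1\<close> by (simp add: nil_bracket_mid basis_vec_apply)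
    qed
  qed (simp_all add: y_props p_1 p_n d_1 d_top)
  then show "br x' (e 1) = csmul (p 2) (e 2) - e 1 + e (n - 1)"
    by (simp add: x'_def br_diff p_def[symmetric] br_nil y_props(1))
  have "nil_bracket n y (e (n - 1)) = 0" "nil_bracket n y (e n) = 0"
    by (simp_all add: fun_eq_iff nil_bracket_def y_props)
  then show "br x' (e (n - 1)) = 0" "br x' (e n) = - e n"
    by (simp_all add: x'_def br_diff q_def[symmetric] q_zero L_n_eq br_nil y_props(1))
  show "2 \<le> i \<Longrightarrow> i \<le> n - 2 \<Longrightarrow> br x' (e i) = 0"
    by (rule br_mid_basis)
  show "br x' x' = 0"
    unfolding x'_right by (simp add: x'_def br_diff s_def[symmetric] D_y)
qed

lemma ext_table_supp:
  assumes "i \<in> {1..n+1}" "j \<in> {1..n+1}"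
  shows "ext_table n c i j \<in> supp (n + 1)"
  using assms n by (auto simp: ext_table_def nil_table_def)

lemma diagonal_classification:
  "table_algebra (n + 1) T \<cong> R1_alg n \<or> table_algebra (n + 1) T \<cong> R2_alg n"
proof -
  define c where "c = (if p 2 = 0 then 0 else 1 :: complex)"
  \<comment> \<open>Scaling with \<open>l = p 2\<close> turns a nonzero coefficient of
    \<open>e_2\<close> in \<open>[x, e_1]\<close> into 1; if it is 0, no scaling is done.\<close>
  define l where "l = (if p 2 = 0 then 1 else p 2)"
  have l: "l \<noteq> 0" and p2: "p 2 = c * l" by (simp_all add: l_def c_def)
  \<comment> \<open>A grading for which the nilpotent product is homogeneous; \<open>e_n\<close> has
    weight 2 like \<open>e_2\<close>, since both occur in \<open>[e_{n-1}, e_1]\<close>. The weights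
    1 of \<open>e_1\<close> and 2 of \<open>e_2\<close> turn the coefficient
    \<open>p 2 = c l\<close> into \<open>c\<close>.\<close>
  define wt where "wt i = (if i = 1 \<or> i = n - 1 then 1 else if i = n then 2 else i)" for i
  define b where "b i = (if i = n + 1 then x' else csmul (l ^ wt i) (e i))" for i
  have x'_coords: "x' \<in> supp (n + 1)" "x' (n + 1) = 1"
    using n supp_mono[OF y_props(1), of "n + 1"] supp_outside[OF y_props(1), of "n + 1"]
    by (auto simp: x'_def basis_vec_apply intro!: supp_diff)
  have bij: "bij_betw (lin csmul b (n + 1)) (supp (n + 1)) (supp (n + 1))"
    by (rule triangular_bij[where r = "\<lambda>i. if i = n + 1 then 0 else 1"])
      (use x'_coords l in \<open>auto simp: b_def basis_vec_apply split: if_splits\<close>)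
  let ?A = "table_algebra (n + 1) T"
  have "bilinear_alg ?A"
    by (rule bilinear_table_algebra) (rule supp_mono[OF T_supp], simp_all)
  moreover have "bij_betw (lin (smul ?A) b (n + 1)) (supp (n + 1)) (carr ?A)"
    using bij by simp
  ultimately obtain T' where T': "?A \<cong> table_algebra (n + 1) T'"
    "\<And>i j. i \<in> {1..n+1} \<Longrightarrow> j \<in> {1..n+1} \<Longrightarrow> T' i j \<in> supp (n + 1)"
    "\<And>i j. i \<in> {1..n+1} \<Longrightarrow> j \<in> {1..n+1} \<Longrightarrow> lin csmul b (n + 1) (T' i j) = br (b i) (b j)"
    by (rule basis_iso) (unfold table_algebra_simps br_def, blast)
  have lin_b: "lin csmul b (n + 1) (e i) = b i" if "1 \<le> i" "i \<le> n + 1" for i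
    using that by (intro lin_basis_vec vector_space_csmul) auto
  note lin_simps = cvec.lin_add cvec.lin_diff cvec.lin_uminus cvec.lin_zero lin_csmul[OF vector_space_csmul] lin_b
  have b_nil: "br (b i) (b j) = lin csmul b (n + 1) (nil_table n i j)" if ij: "i \<in> {1..n}" "j \<in> {1..n}" for i j
  proof -
    have "br (b i) (b j) = csmul (l ^ (wt i + wt j)) (nil_table n i j)"
    proof -
      have "br (e i) (e j) = nil_table n i j" using ij by (simp add: br_basis T_nil)
      then show ?thesis using ij by (simp add: b_def br_bilinear power_add mult.commute)
    qed
    also have "\<dots> = lin csmul b (n + 1) (nil_table n i j)"
    proof -
      consider "1 \<le> i \<and> i \<le> n - 3 \<and> j = 1" | "\<not> (1 \<le> i \<and> i \<le> n - 3 \<and> j = 1)" "i = n - 1 \<and> j = 1"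
        | "\<not> (1 \<le> i \<and> i \<le> n - 3 \<and> j = 1)" "\<not> (i = n - 1 \<and> j = 1)" "i = 1 \<and> j = n - 1"
        | "nil_table n i j = 0"
        unfolding nil_table_def by presburger
      then show ?thesis
      proof cases
        case 1
        then have "i + 1 \<noteq> 1" "i + 1 \<noteq> n - 1" "i + 1 \<noteq> n" "i + 1 \<noteq> n + 1" "i \<noteq> n - 1" "i \<noteq> n" using n by auto
        then show ?thesis using 1 n by (auto simp: nil_table_def lin_simps b_def wt_def)
      next
        case 2
        have "nil_table n i j = e n + e 2"
          by (simp only: nil_table_def if_not_P[OF 2(1)] if_P[OF 2(2)])
        then show ?thesis using 2 n by (simp add: lin_simps b_def wt_def cvec.scale_right_distrib)
      next
        case 3
        have "nil_table n i j = - e n"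
          by (simp only: nil_table_def if_not_P[OF 3(1)] if_not_P[OF 3(2)] if_P[OF 3(3)])
        then show ?thesis using 3 n by (simp add: lin_simps b_def wt_def)
      next
        case 4
        then show ?thesis by (simp add: lin_simps)
      qed
    qed
    finally show ?thesis .
  qed
  have b_x: "br (b i) (b (n + 1)) = lin csmul b (n + 1) (ext_table n c i (n + 1))" if i: "i \<in> {1..n}" for i
  proof -
    have "br (b i) (b (n + 1)) = csmul (l ^ wt i) (br (e i) x)"
      using i by (simp add: b_def br_bilinear x'_right)
    moreover have "i \<in> {1..n+1}" "i \<noteq> n + 1" using i by auto
    then have "csmul (l ^ wt i) (br (e i) x) = lin csmul b (n + 1) (ext_table n c i (n + 1))"
    proof (cases rule: mid_cases)
      case 1
      then show ?thesis using n
        by (simp add: ext_table_def lin_simps b_def wt_def d_def[symmetric] d_eq cvec.scale_right_diff_distrib)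
    next
      case 2
      then show ?thesis using n
        by (simp add: ext_table_def nil_table_def lin_simps m_def[symmetric] m_eq)
    next
      case 3
      then show ?thesis using n
        by (simp add: ext_table_def lin_simps b_def wt_def D_n' d_1)
    next
      case 5
      then show ?thesis using n
        by (simp add: ext_table_def lin_simps b_def wt_def D_mid' mult.commute)
    qed simp
    ultimately show ?thesis by simp
  qed
  have x_b: "br (b (n + 1)) (b j) = lin csmul b (n + 1) (ext_table n c (n + 1) j)" if j: "j \<in> {1..n}" for j
  proof -
    have "br (b (n + 1)) (b j) = csmul (l ^ wt j) (br x' (e j))"
      using j by (simp add: b_def br_bilinear)
    moreover have "j \<in> {1..n+1}" "j \<noteq> n + 1" using j by auto
    then have "csmul (l ^ wt j) (br x' (e j)) = lin csmul b (n + 1) (ext_table n c (n + 1) j)"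
    proof (cases rule: mid_cases)
      case 1
      then show ?thesis using n
        by (simp add: ext_table_def lin_simps b_def wt_def x'_left p2 cvec.scale_right_distrib
            cvec.scale_right_diff_distrib power2_eq_square mult_ac)
    next
      case 2
      then show ?thesis using n
        by (simp add: ext_table_def nil_table_def lin_simps x'_left)
    next
      case 3
      then show ?thesis using n
        by (simp add: ext_table_def lin_simps b_def wt_def x'_left)
    next
      case 5
      then show ?thesis using n
        by (simp add: ext_table_def nil_table_def lin_simps x'_left)
    qed simp
    ultimately show ?thesis by simp
  qed
  have table: "br (b i) (b j) = lin csmul b (n + 1) (ext_table n c i j)" if ij: "i \<in> {1..n+1}" "j \<in> {1..n+1}" for i j
  proof -
    consider "i \<in> {1..n}" "j \<in> {1..n}" "i \<noteq> n + 1" "j \<noteq> n + 1" | "i \<in> {1..n}" "j = n + 1" | "i = n + 1" "j \<in> {1..n}" | "i = n + 1" "j = n + 1"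
      using ij by fastforce
    then show ?thesis
    proof cases
      case 1
      then show ?thesis using b_nil[OF 1(1,2)] by (simp add: ext_table_def)
    next
      case 4
      then show ?thesis by (simp add: ext_table_def nil_table_def b_def x'_left lin_simps)
    qed (simp_all add: b_x x_b)
  qed
  have "T' i j = ext_table n c i j" if "i \<in> {1..n+1}" "j \<in> {1..n+1}" for i j
    using inj_onD[OF bij_betw_imp_inj_on[OF bij]] T'(2,3)[OF that] table[OF that] ext_table_supp[OF that] by simp
  then have "table_algebra (n + 1) T' = table_algebra (n + 1) (ext_table n c)"
    by (rule table_bracket_cong)
  then show ?thesis
    using T'(1) by (cases "p 2 = 0") (simp_all add: c_def ext_table_R R1_alg_def R2_alg_def)
qed

end

end

section \<open>From the abstract algebra to structure constants\<close>

text \<open>The isomorphism maps each term of the lower central series of \<open>A\<close> into the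
  corresponding term of \<open>B\<close>; injectivity then carries vanishing back.\<close>

lemma nilpotent_alg_transport:
  assumes iso: "A \<cong> B" and A: "bilinear_alg A" and B: "bilinear_alg B" and nil: "nilpotent_alg B"
  shows "nilpotent_alg A"
proof -
  interpret A: vector_space "smul A" using A by (simp add: bilinear_alg_def)
  interpret B: vector_space "smul B" using B by (simp add: bilinear_alg_def)
  have subA: "A.subspace (carr A)" using A by (simp add: bilinear_alg_def)
  obtain f where f: "bij_betw f (carr A) (carr B)" 
      "\<And>x y. x \<in> carr A \<Longrightarrow> y \<in> carr A \<Longrightarrow> f (x + y) = f x + f y"
      "\<And>c x. x \<in> carr A \<Longrightarrow> f (smul A c x) = smul B c (f x)"
      "\<And>x y. x \<in> carr A \<Longrightarrow> y \<in> carr A \<Longrightarrow> f (bracket A x y) = bracket B (f x) (f y)"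
    by (rule isomorphic_algE[OF iso], rule that; assumption)
  have f0: "f 0 = 0" using f(3)[of 0 0] A.subspace_0[OF subA] by simp
  have sub: "lower_central A k \<subseteq> {u \<in> carr A. f u \<in> lower_central B k}" for k
  proof (induction k)
    case 0
    show ?case using f(1) by (auto simp: bij_betw_def)
  next
    case (Suc k)
    have "A.subspace {u \<in> carr A. f u \<in> lower_central B (Suc k)}"
      unfolding A.subspace_def lower_central.simps product_space_def
      using subA by (auto simp: A.subspace_def f f0 B.span_zero B.span_add B.span_scale)
    moreover have "{bracket A u v |u v. u \<in> lower_central A k \<and> v \<in> carr A}
        \<subseteq> {u \<in> carr A. f u \<in> lower_central B (Suc k)}"
    proof clarify
      fix u v assume uv: "u \<in> lower_central A k" "v \<in> carr A"
      then have "u \<in> carr A" "f u \<in> lower_central B k" "f v \<in> carr B"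
        using Suc f(1) by (auto simp: bij_betw_def)
      then show "bracket A u v \<in> carr A \<and> f (bracket A u v) \<in> lower_central B (Suc k)"
        using uv A by (auto simp: f(4) product_space_def bilinear_alg_def intro!: B.span_base)
    qed
    ultimately show ?case
      unfolding lower_central.simps(2)[of A] product_space_def[of A] by (rule A.span_minimal[rotated])
  qed
  from nil obtain k where "lower_central B k = {0}" by (auto simp: nilpotent_alg_def)
  then have "u = 0" if "u \<in> lower_central A k" for u
    using sub[of k] that inj_onD[OF bij_betw_imp_inj_on[OF f(1)], of u 0] f0 A.subspace_0[OF subA] by auto
  moreover have "0 \<in> lower_central A k"
    by (cases k) (simp_all add: A.subspace_0[OF subA] product_space_def A.span_zero)
  ultimately have "lower_central A k = {0}" by blast
  then show ?thesis by (auto simp: nilpotent_alg_def)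
qed

lemma codim_one_obtain:
  assumes A: "bilinear_alg A" and codim: "codim_one A N" and N: "module.subspace (smul A) N"
  obtains z where "z \<in> carr A" "z \<notin> N" "carr A = {u + smul A c z |u c. u \<in> N}"
proof -
  interpret vector_space "smul A" using A by (simp add: bilinear_alg_def)
  from codim obtain Q where Q: "subspace Q" "N \<inter> Q = {0}" "{u + q |u q. u \<in> N \<and> q \<in> Q} = carr A" "dim Q = 1"
    unfolding codim_one_def by blast
  obtain B where B: "B \<subseteq> Q" "independent B" "Q \<subseteq> span B" "card B = 1"
    using basis_exists[of Q] Q(4) by metis
  obtain z where z: "B = {z}" using B(4) by (rule card_1_singletonE)
  then have z0: "z \<noteq> 0" "z \<in> Q" using B dependent_zero by auto
  have Qz: "Q = range (\<lambda>c. smul A c z)"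
    using B(3) z z0(2) Q(1) by (auto simp: span_singleton subspace_scale)
  show ?thesis
  proof
    have "0 + z \<in> carr A" unfolding Q(3)[symmetric] using z0(2) subspace_0[OF N] by blast
    then show "z \<in> carr A" by simp
    show "z \<notin> N" using Q(2) z0 by blast
    show "carr A = {u + smul A c z |u c. u \<in> N}"
      unfolding Q(3)[symmetric] Qz by blast
  qed
qed

text \<open>A nilpotent algebra is a nilpotent ideal of itself and would be contained in its
  nilradical.\<close>

lemma nilradical_not_nilpotent:
  assumes A: "bilinear_alg A" and "nilradical A N" "z \<in> carr A" "z \<notin> N"
  shows "\<not> nilpotent_alg A"
proof
  assume "nilpotent_alg A"
  moreover have "A\<lparr>carr := carr A\<rparr> = A" by simp
  moreover have "ideal_of A (carr A)"
    using A by (simp add: ideal_of_def bilinear_alg_def)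
  ultimately have "carr A \<subseteq> N" using assms(2) unfolding nilradical_def by metis
  then show False using assms(3,4) by blast
qed

text \<open>The standard basis of the nilpotent algebra is pulled back to \<open>N\<close> and
  completed by a vector outside \<open>N\<close>, scaled so that the eigenvalue on
  \<open>e_1\<close> is 0 or 1.\<close>

lemma adapted_table:
  fixes R :: "'a::ab_group_add alg"
  assumes n: "n \<ge> 5" and A: "bilinear_alg R" and leib: "leibniz_id R"
    and ideal: "ideal_of R N" and codim: "codim_one R N" and iso: "R\<lparr>carr := N\<rparr> \<cong> nil_alg n"
  obtains T where "R \<cong> table_algebra (n + 1) T" "nil_extension n T" "T 1 (n + 1) 1 \<in> {0, 1}"
proof -
  interpret vector_space "smul R" using A by (simp add: bilinear_alg_def)
  have N: "subspace N" "N \<subseteq> carr R" 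
    and ideal': "\<And>y z. y \<in> carr R \<Longrightarrow> z \<in> N \<Longrightarrow> bracket R y z \<in> N"
      "\<And>y z. y \<in> carr R \<Longrightarrow> z \<in> N \<Longrightarrow> bracket R z y \<in> N"
    using ideal by (auto simp: ideal_of_def)
  have cl: "\<And>y z. y \<in> carr R \<Longrightarrow> z \<in> carr R \<Longrightarrow> bracket R y z \<in> carr R" 
    and add: "\<And>w y z. w \<in> carr R \<Longrightarrow> y \<in> carr R \<Longrightarrow> z \<in> carr R \<Longrightarrow> 
        bracket R z (w + y) = bracket R z w + bracket R z y" and
     sc: "\<And>c y z. y \<in> carr R \<Longrightarrow> z \<in> carr R \<Longrightarrow> bracket R y (smul R c z) = smul R c (bracket R y z)"
        "\<And>c y z. y \<in> carr R \<Longrightarrow> z \<in> carr R \<Longrightarrow> bracket R (smul R c y) z = smul R c (bracket R y z)"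
     and subR: "subspace (carr R)"
    using A by (simp_all add: bilinear_alg_def)
  have N_cancel: "c = 0" if "smul R c w \<in> N" "w \<notin> N" for c w
  proof (rule ccontr)
    assume "c \<noteq> 0"
    then have "w = smul R (1 / c) (smul R c w)" by simp
    then show False using subspace_scale[OF N(1) that(1)] that(2) by metis
  qed
  obtain g where g: "bij_betw g N (supp n)" 
      "\<And>x y. x \<in> N \<Longrightarrow> y \<in> N \<Longrightarrow> g (x + y) = g x + g y"
      "\<And>c x. x \<in> N \<Longrightarrow> g (smul R c x) = csmul c (g x)"
      "\<And>x y. x \<in> N \<Longrightarrow> y \<in> N \<Longrightarrow> g (bracket R x y) = bracket (nil_alg n) (g x) (g y)"
    using isomorphic_algE[OF iso] by (simp add: nil_alg_def) blast
  define E where "E i = inv_into N g (e i)" for i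
  have E: "E i \<in> N" "g (E i) = e i" if "i \<in> {1..n}" for i
    using that bij_betw_inv_into_right[OF g(1), of "e i"] bij_betw_apply[OF bij_betw_inv_into[OF g(1)], of "e i"]
    by (auto simp: E_def)
  obtain z where z: "z \<in> carr R" "z \<notin> N" "carr R = {u + smul R c z |u c. u \<in> N}"
    by (rule codim_one_obtain[OF A codim N(1)])
  \<comment> \<open>The eigenvalue on \<open>e_1\<close> before scaling; \<open>a'\<close> makes it
    1 when it is nonzero and is 1 otherwise, so that \<open>X\<close> stays outside
    \<open>N\<close>.\<close>
  define a where "a = g (bracket R (E 1) z) 1"
  define a' where "a' = (if a = 0 then 1 else 1 / a)"
  define X where "X = smul R a' z"
  have a': "a' \<noteq> 0" "a' * a \<in> {0, 1}" by (auto simp: a'_def)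
  have X: "X \<in> carr R" "X \<notin> N" 
    using z(1,2) a'(1) N_cancel[of a' z] by (auto simp: X_def subspace_scale[OF subR])
  have RX: "carr R = {u + smul R c X |u c. u \<in> N}"
  proof -
    have "smul R c z = smul R (c / a') X" for c using a' by (simp add: X_def)
    moreover have "smul R c X = smul R (c * a') z" for c by (simp add: X_def)
    ultimately show ?thesis unfolding z(3) by metis
  qed
  have E1: "E 1 \<in> N" using E(1)[of 1] n by simp
  have a_X: "g (bracket R (E 1) X) 1 \<in> {0, 1}"
    using a' z(1) N(2) E1 by (auto simp: X_def sc g(3) ideal' a_def)
  define b where "b i = (if i = n + 1 then X else E i)" for i
  define h where "h c = (\<Sum>k=1..n. smul R (c k) (E k))" for c
  have lin_b: "lin (smul R) b (n + 1) c = h c + smul R (c (n + 1)) X" for c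
  proof -
    have "(\<Sum>k=1..n. smul R (c k) (b k)) = h c"
      unfolding h_def by (intro sum.cong) (auto simp: b_def)
    moreover have "(\<Sum>k=1..Suc n. smul R (c k) (b k)) = (\<Sum>k=1..n. smul R (c k) (b k)) + smul R (c (Suc n)) (b (Suc n))"
      by simp
    ultimately show ?thesis by (simp add: lin_def b_def flip: Suc_eq_plus1)
  qed
  have h_N: "h c \<in> N" for c
    unfolding h_def using E by (intro subspace_sum[OF N(1)] subspace_scale[OF N(1)])
  have g0: "g 0 = 0" using g(3)[of 0 0] subspace_0[OF N(1)] by simp
  have g_h: "g (h c) = c" if "c \<in> supp n" for c
  proof -
    have *: "g (\<Sum>k\<in>I. smul R (c k) (E k)) = (\<Sum>k\<in>I. csmul (c k) (e k)) \<and> (\<Sum>k\<in>I. smul R (c k) (E k)) \<in> N" 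
      if "I \<subseteq> {1..n}" for I
    proof -
      have "finite I" using that finite_subset by blast
      then show ?thesis using that
      proof (induction I)
        case empty
        show ?case by (simp only: sum.empty g0 subspace_0[OF N(1)] simp_thms)
      next
        case (insert k I)
        then have k: "k \<in> {1..n}" "I \<subseteq> {1..n}" by auto
        have kN: "smul R (c k) (E k) \<in> N" using E(1)[OF k(1)] by (rule subspace_scale[OF N(1)])
        have IH: "g (\<Sum>k\<in>I. smul R (c k) (E k)) = (\<Sum>k\<in>I. csmul (c k) (e k))" "(\<Sum>k\<in>I. smul R (c k) (E k)) \<in> N"
          using insert.IH k(2) by blast+
        show ?case
          by (simp only: sum.insert[OF insert.hyps] g(2)[OF kN IH(2)] IH(1) g(3)[OF E(1)[OF k(1)]] E(2)[OF k(1)]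
              subspace_add[OF N(1) kN IH(2)] simp_thms)
      qed
    qed
    have "g (h c) = lin csmul e n c" using *[of "{1..n}"] by (simp add: h_def lin_def)
    then show ?thesis using lin_self[OF that] by simp
  qed
  have bij: "bij_betw (lin (smul R) b (n + 1)) (supp (n + 1)) (carr R)"
    unfolding bij_betw_def
  proof
    show "inj_on (lin (smul R) b (n + 1)) (supp (n + 1))"
    proof (rule inj_onI)
      fix u v assume uv: "u \<in> supp (n + 1)" "v \<in> supp (n + 1)" "lin (smul R) b (n + 1) u = lin (smul R) b (n + 1) v"
      define c where "c = u - v"
      have c: "c \<in> supp (n + 1)" "lin (smul R) b (n + 1) c = 0" using uv by (simp_all add: c_def lin_diff)
      have "smul R (c (n + 1)) X = - h c"
        using minus_unique[of "h c"] c(2) unfolding lin_b by metis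
      then have "smul R (c (n + 1)) X \<in> N" using h_N[of c] subspace_neg[OF N(1)] by simp
      then have cn: "c (n + 1) = 0" using N_cancel X(2) by blast
      have "k = n + 1 \<or> k \<notin> {1..n+1}" if "k \<notin> {1..n}" for k using that by auto
      then have "c \<in> supp n" using c(1) cn unfolding supp_def by blast
      moreover have "h c = 0" using c(2) cn by (simp add: lin_b)
      ultimately have "c = 0" using g_h[of c] g0 by simp
      then show "u = v" by (simp add: c_def)
    qed
    show "lin (smul R) b (n + 1) ` supp (n + 1) = carr R"
    proof (intro equalityI subsetI)
      fix y assume "y \<in> lin (smul R) b (n + 1) ` supp (n + 1)"
      then show "y \<in> carr R" using h_N by (auto simp: lin_b RX)
    next
      fix y assume "y \<in> carr R"
      then obtain u c where u: "u \<in> N" "y = u + smul R c X" unfolding RX by blast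
      define w where "w = (g u)(n + 1 := c)"
      have gu: "g u \<in> supp n" using bij_betw_apply[OF g(1) u(1)] .
      have "g (h (g u)) = g u" using g_h[OF gu] .
      then have "h (g u) = u" using inj_onD[OF bij_betw_imp_inj_on[OF g(1)]] h_N u(1) by blast
      moreover have "h w = h (g u)" unfolding h_def w_def by (intro sum.cong) auto
      ultimately have "lin (smul R) b (n + 1) w = y" by (simp add: lin_b u(2)) (simp add: w_def)
      moreover have "w \<in> supp (n + 1)" using gu by (auto simp: w_def supp_def)
      ultimately show "y \<in> lin (smul R) b (n + 1) ` supp (n + 1)" by blast
    qed
  qed
  obtain T where T: "R \<cong> table_algebra (n + 1) T"
    "\<And>i j. i \<in> {1..n+1} \<Longrightarrow> j \<in> {1..n+1} \<Longrightarrow> T i j \<in> supp (n + 1)"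
    "\<And>i j. i \<in> {1..n+1} \<Longrightarrow> j \<in> {1..n+1} \<Longrightarrow> lin (smul R) b (n + 1) (T i j) = bracket R (b i) (b j)"
    by (rule basis_iso[OF A bij], rule that; assumption)
  \<comment> \<open>Writing \<open>[X, X] = u + c X\<close>, the relation
    \<open>[X, [X, X]] = 0\<close> has \<open>X\<close> component \<open>c^2\<close>, hence
    \<open>c = 0\<close>.\<close>
  have XX: "bracket R X X \<in> N"
  proof -
    obtain u c where u: "u \<in> N" "bracket R X X = u + smul R c X"
      using cl[OF X(1) X(1)] unfolding RX by blast
    have "bracket R X (bracket R X X) = 0"
      using leib X(1) by (simp add: leibniz_id_def)
    moreover have "bracket R X (bracket R X X) = bracket R X u + smul R c (u + smul R c X)"
      using u X(1) N(2) by (auto simp: add sc subspace_scale[OF subR])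
    ultimately have "(bracket R X u + smul R c u) + smul R (c * c) X = 0"
      by (simp add: add.assoc scale_right_distrib)
    then have "smul R (c * c) X = - (bracket R X u + smul R c u)"
      by (rule minus_unique[symmetric])
    also have "\<dots> \<in> N"
      using u X(1) by (intro subspace_neg[OF N(1)] subspace_add[OF N(1)] subspace_scale[OF N(1)] ideal') auto
    finally have "c * c = 0" using N_cancel X(2) by blast
    then show ?thesis using u by simp
  qed
  have bN: "bracket R (b i) (b j) \<in> N" if "i \<in> {1..n+1}" "j \<in> {1..n+1}" for i j
  proof -
    have b: "b k \<in> carr R \<and> (k = n + 1 \<and> b k = X \<or> b k \<in> N)" if "k \<in> {1..n+1}" for k
      using that E[of k] N(2) X(1) by (cases "k = n + 1") (auto simp: b_def)
    show ?thesis using b[OF that(1)] b[OF that(2)] ideal' XX by auto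
  qed
  have T_supp: "T i j \<in> supp n" if ij: "i \<in> {1..n+1}" "j \<in> {1..n+1}" for i j
  proof -
    have "smul R (T i j (n + 1)) X = bracket R (b i) (b j) - h (T i j)"
      unfolding T(3)[OF ij, symmetric] lin_b by simp
    then have "smul R (T i j (n + 1)) X \<in> N" using bN[OF ij] h_N subspace_diff[OF N(1)] by simp
    then have "T i j (n + 1) = 0" using N_cancel X(2) by blast
    moreover have "k = n + 1 \<or> k \<notin> {1..n+1}" if "k \<notin> {1..n}" for k using that by auto
    ultimately show ?thesis using T(2)[OF ij] unfolding supp_def by blast
  qed
  have T_g: "T i j = g (bracket R (b i) (b j))" if ij: "i \<in> {1..n+1}" "j \<in> {1..n+1}" for i j
  proof -
    have "T i j (n + 1) = 0" using supp_outside[OF T_supp[OF ij]] by simp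
    then have "h (T i j) = bracket R (b i) (b j)" using T(3)[OF ij] by (simp add: lin_b)
    then show ?thesis using g_h[OF T_supp[OF ij]] by simp
  qed
  have "nil_extension n T"
  proof
    show "T i j = nil_table n i j" if "i \<in> {1..n}" "j \<in> {1..n}" for i j
    proof -
      have "T i j = bracket (nil_alg n) (e i) (e j)"
        using that E by (simp add: T_g b_def g(4))
      then show ?thesis using table_bracket_basis[OF that] by (simp add: nil_alg_def)
    qed
    show "leibniz_id (table_algebra (n + 1) T)" using T(1) A leib by (rule leibniz_id_transport)
  qed (use n T_supp in auto)
  moreover have "T 1 (n + 1) 1 \<in> {0, 1}"
    using a_X n by (simp add: T_g b_def)
  ultimately show ?thesis using that T(1) by blast
qed

theorem theorem3p1:
  fixes n :: nat
  assumes "n \<ge> 5"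
  shows "(\<forall>(R :: 'a::ab_group_add alg) N.
            leibniz_algebra R \<and> solvable_alg R \<and> nilradical R N \<and>
            codim_one R N \<and> R\<lparr>carr := N\<rparr> \<cong> nil_alg n
            \<longrightarrow> R \<cong> R1_alg n \<or> R \<cong> R2_alg n)
         \<and> \<not> R1_alg n \<cong> R2_alg n"
proof (intro conjI allI impI)
  show "\<not> R1_alg n \<cong> R2_alg n" using assms by (rule R1_not_isomorphic_R2)
next
  fix R :: "'a alg" and N
  assume R: "leibniz_algebra R \<and> solvable_alg R \<and> nilradical R N \<and>
            codim_one R N \<and> R\<lparr>carr := N\<rparr> \<cong> nil_alg n"
  then have A: "bilinear_alg R" "leibniz_id R" and nilrad: "nilradical R N" and codim: "codim_one R N"
    by (auto intro: leibniz_algebraD)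
  have ideal: "ideal_of R N" using nilrad by (simp add: nilradical_def)
  obtain T where T: "R \<cong> table_algebra (n + 1) T" "nil_extension n T" "T 1 (n + 1) 1 \<in> {0, 1}"
    using adapted_table[OF assms A ideal codim] R by blast
  interpret T: nil_extension n T by (rule T(2))
  have d: "T.d = T 1 (n + 1)" unfolding T.d_def by (rule T.br_basis) simp_all
  \<comment> \<open>Otherwise \<open>R\<close> would be nilpotent and equal to its nilradical,
    contrary to codimension one. With the normalization to 0 or 1 this leaves the value 1.\<close>
  have "T.d 1 \<noteq> 0"
  proof
    assume "T.d 1 = 0"
    then have "nilpotent_alg (table_algebra (n + 1) T)" by (rule T.nilpotent_case)
    moreover have "bilinear_alg (table_algebra (n + 1) T)"
      by (rule bilinear_table_algebra) (rule supp_mono[OF T.T_supp], simp_all)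
    ultimately have "nilpotent_alg R" using nilpotent_alg_transport[OF T(1) A(1)] by blast
    moreover obtain z where "z \<in> carr R" "z \<notin> N"
      by (rule codim_one_obtain[OF A(1) codim]) (use ideal in \<open>simp add: ideal_of_def\<close>)
    ultimately show False using nilradical_not_nilpotent[OF A(1) nilrad] by blast
  qed
  then have "T.d 1 = 1" using T(3) d by simp
  then obtain T' where T': "nil_extension n T'" "table_algebra (n + 1) T \<cong> table_algebra (n + 1) T'"
    "T' 1 (n + 1) = e 1 - e (n - 1)" "T' (n - 1) (n + 1) = 0"
    by (rule T.diagonalize)
  interpret T': nil_extension n T' by (rule T'(1))
  have "T'.d = e 1 - e (n - 1)" "T'.m = 0"
    unfolding T'.d_def T'.m_def using T'(3,4) by (simp_all add: T'.br_basis)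
  then have "table_algebra (n + 1) T' \<cong> R1_alg n \<or> table_algebra (n + 1) T' \<cong> R2_alg n"
    by (rule T'.diagonal_classification)
  then show "R \<cong> R1_alg n \<or> R \<cong> R2_alg n"
    using isomorphic_alg_trans[OF T(1) isomorphic_alg_trans[OF T'(2)]] by blast
qed

end
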